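(* Let $d,t\in\mathbb N$ and let $V\subseteq C^{2^-\text{-var}}(\mathbb R^t)$ be a path variety. (1) Let $p:\mathbb R^d\to\mathbb R^t$ be a polynomial map with $p(0)=0$. The set of all $X\in C^{2^-\text{-var}}(\mathbb R^d)$ such that $p(X-X_0)\in V$ is a path variety, given by $\mathcal V(M_p\,\mathcal I(V))$. (2) Let $B:\mathbb R^t\to T^{\ge1}(\mathbb R^d)$ be linear. The set of all $X\in C^{2^-\text{-var}}(\mathbb R^d)$ such that $\Lambda_B^*X\in V$, where $(\Lambda_B^*X)_s:=(\langle\sigma(X|_{[0,s]}),B(1)\rangle,\dots,\langle\sigma(X|_{[0,s]}),B(t)\rangle)$, is a path variety, given by $\mathcal V(\Lambda_B\,\mathcal I(V))$.
   Context: For $d\in\mathbb N$, $C^{2^-\text{-var}}(\mathbb R^d)$ is the set of all continuous $X:[0,T]\to\mathbb R^d$, with $T\in(0,\infty)$ depending on $X$, that have finite $q$-variation for some $q\in[1,2)$. Its elements are called paths. $T(\mathbb R^d)$ is the tensor algebra, identified with the real vector space spanned by the words in the letters $1,\dots,d$, including the empty word $\mathsf e$; $T^{\ge1}(\mathbb R^d)$ is the span of nonempty words; $T((\mathbb R^d))$ is the linear dual of $T(\mathbb R^d)$. The signature $\sigma(X)\in T((\mathbb R^d))$ is given by $\langle\sigma(X),\mathsf e\rangle=1$ and $\langle\sigma(X),i_1\cdots i_n\rangle=\int_{0<t_1<\dots<t_n<T}dX^{[i_1]}_{t_1}\cdots dX^{[i_n]}_{t_n}$ (iterated Riemann–Stieltjes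 integrals); $\sigma(X|_{[0,s]})$ is the signature of the path stopped at time $s$, with $\sigma(X|_{[0,0]})=\mathsf e$. For $W\subseteq T(\mathbb R^d)$, $\mathcal V(W)=\{X\in C^{2^-\text{-var}}(\mathbb R^d)\mid\langle\sigma(X),x\rangle=0\ \forall x\in W\}$; such sets are called path varieties. $\mathcal I(M)=\{x\in T(\mathbb R^d)\mid\langle\sigma(X),x\rangle=0\ \forall X\in M\}$ for a set of paths $M$. The right halfshuffle $\succ$ is the bilinear operation on $T^{\ge1}(\mathbb R^d)$ defined recursively for nonempty words $w,v$ and a letter $i$ by $w\succ i=wi$ and $w\succ vi=(w\succ v+v\succ w)i$. The shuffle product is the commutative associative product with unit $\mathsf e$ given on $T^{\ge1}$ by $x\succ y+y\succ x$. The letters $1,\dots,t$ are identified with the standard basis of $\mathbb R^t$. For linear $B:\mathbb R^t\to T^{\ge1}(\mathbb R^d)$, the linear map $\Lambda_B:T(\mathbb R^t)\to T(\mathbb R^d)$ is recursively defined by $\Lambda_B\mathsf e=\mathsf e$, $\Lambda_Bi=B(i)$ and $\Lambda_B(wi)=\Lambda_Bw\succ\Lambda_Bi$ for nonempty words $w$ and letters $i$. For a polynomial map $p=(p_1,\dots,p_t):\mathbb R^d\to\mathbb R^t$ with $p(0)=0$, $\varphi(p_i)\in T^{\ge1}(\mathbb R^d)$ is the image of $p_i$ under the unique unital algebra homomorphism from $\mathbb R[x_1,\dots,x_d]$ to $T(\mathbb R^d)$ with the shuffle product sending $x_j$ to the letter $j$, and $M_p:=\Lambda_B$ for $B(i)=\varphi(p_i)$.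 *)

theory Defs
  imports "HOL-Analysis.Analysis" "HOL-Analysis.Finite_Function_Topology"
begin

section \<open>Tensor algebra, halfshuffle and shuffle\<close>

text \<open>
  The letters are the elements of a finite index type, so that the dimension of
  \<^typ>\<open>real ^ 'd\<close> is the number of letters. The tensor algebra is the free real vector space
  on words (with the vector space structure on finitely supported functions from
  \<^theory>\<open>HOL-Analysis.Finite_Function_Topology\<close>); an element of its linear dual is
  given by its values on words.
\<close>

type_synonym 'd tensor = "'d list \<Rightarrow>\<^sub>0 real"
type_synonym 'd dual_tensor = "'d list \<Rightarrow> real"

definition word :: "'d list \<Rightarrow> 'd tensor"
  where "word w = Poly_Mapping.single w 1"

definition pairing :: "'d dual_tensor \<Rightarrow> 'd tensor \<Rightarrow> real"
  where "pairing \<sigma> x = (\<Sum>w\<in>Poly_Mapping.keys x. Poly_Mapping.lookup x w * \<sigma> w)"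

definition tensor_ge1 :: "'d tensor set"
  where "tensor_ge1 = span (word ` {w. w \<noteq> []})"

definition linear_ext :: "('d list \<Rightarrow> 'e tensor) \<Rightarrow> 'd tensor \<Rightarrow> 'e tensor"
  where "linear_ext f x =
    (\<Sum>w\<in>Poly_Mapping.keys x. Poly_Mapping.lookup x w *\<^sub>R f w)"

definition bilinear_ext ::
  "('d list \<Rightarrow> 'd list \<Rightarrow> 'd tensor) \<Rightarrow> 'd tensor \<Rightarrow> 'd tensor \<Rightarrow> 'd tensor"
  where "bilinear_ext f x y =
    (\<Sum>w\<in>Poly_Mapping.keys x. \<Sum>v\<in>Poly_Mapping.keys y.
      (Poly_Mapping.lookup x w * Poly_Mapping.lookup y v) *\<^sub>R f w v)"

definition append_letter :: "'d tensor \<Rightarrow> 'd \<Rightarrow> 'd tensor"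
  where "append_letter x i = linear_ext (\<lambda>w. word (w @ [i])) x"

text \<open>
  The halfshuffle is only meaningful on \<^const>\<open>tensor_ge1\<close>; the value 0 when one of the words
  is empty is a dummy. The two lemmas below are the defining recursion.
\<close>

function halfshuffle_word :: "'d list \<Rightarrow> 'd list \<Rightarrow> 'd tensor"
  where "halfshuffle_word w v =
    (if w = [] \<or> v = [] then 0
     else if butlast v = [] then word (w @ [last v])
     else append_letter (halfshuffle_word w (butlast v) + halfshuffle_word (butlast v) w) (last v))"
  by auto
termination
  by (relation "Wellfounded.measure (\<lambda>(w, v). length w + length v)") auto

declare halfshuffle_word.simps [simp del]

lemma halfshuffle_word_letter:
  "w \<noteq> [] \<Longrightarrow> halfshuffle_word w [i] = word (w @ [i])"
  by (simp add: halfshuffle_word.simps)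

lemma halfshuffle_word_snoc:
  "w \<noteq> [] \<Longrightarrow> v \<noteq> [] \<Longrightarrow> halfshuffle_word w (v @ [i]) =
    append_letter (halfshuffle_word w v + halfshuffle_word v w) i"
  by (simp add: halfshuffle_word.simps[of w "v @ [i]"])

definition halfshuffle :: "'d tensor \<Rightarrow> 'd tensor \<Rightarrow> 'd tensor"
  where "halfshuffle = bilinear_ext halfshuffle_word"

definition shuffle :: "'d tensor \<Rightarrow> 'd tensor \<Rightarrow> 'd tensor"
  where "shuffle = bilinear_ext (\<lambda>w v.
    if w = [] then word v
    else if v = [] then word w
    else halfshuffle_word w v + halfshuffle_word v w)"

section \<open>The maps Lambda_B and M_p\<close>

text \<open>The recursion removes the last letter of a word, so it runs over the reversed word.\<close>

fun Lambda_rev :: "(real ^ 't \<Rightarrow> 'd tensor) \<Rightarrow> 't list \<Rightarrow> 'd tensor"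
  where
    "Lambda_rev B [] = word []"
  | "Lambda_rev B [i] = B (axis i 1)"
  | "Lambda_rev B (i # j # w) = halfshuffle (Lambda_rev B (j # w)) (B (axis i 1))"

definition Lambda :: "(real ^ 't \<Rightarrow> 'd tensor) \<Rightarrow> 't tensor \<Rightarrow> 'd tensor"
  where "Lambda B = linear_ext (\<lambda>w. Lambda_rev B (rev w))"

lemma Lambda_empty: "Lambda B (word []) = word []"
  by (simp add: Lambda_def linear_ext_def word_def)

lemma Lambda_letter: "Lambda B (word [i]) = B (axis i 1)"
  by (simp add: Lambda_def linear_ext_def word_def)

lemma Lambda_snoc:
  assumes "w \<noteq> []"
  shows "Lambda B (word (w @ [i])) = halfshuffle (Lambda B (word w)) (Lambda B (word [i]))"
proof -
  obtain j u where "rev w = j # u"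
    using assms by (cases "rev w") auto
  then show ?thesis
    by (simp add: Lambda_def linear_ext_def word_def)
qed

type_synonym 'd poly_ring = "('d \<Rightarrow>\<^sub>0 nat) \<Rightarrow>\<^sub>0 real"

definition poly_var :: "'d \<Rightarrow> 'd poly_ring"
  where "poly_var j = Poly_Mapping.single (Poly_Mapping.single j 1) 1"

definition poly_eval :: "('d::finite) poly_ring \<Rightarrow> real ^ 'd \<Rightarrow> real"
  where "poly_eval p a =
    (\<Sum>m\<in>Poly_Mapping.keys p. Poly_Mapping.lookup p m * (\<Prod>j\<in>UNIV. (a $ j) ^ Poly_Mapping.lookup m j))"

definition poly_map :: "('t \<Rightarrow> ('d::finite) poly_ring) \<Rightarrow> real ^ 'd \<Rightarrow> real ^ 't"
  where "poly_map p a = (\<chi> i. poly_eval (p i) a)"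

definition shuffle_hom :: "('d poly_ring \<Rightarrow> 'd tensor) \<Rightarrow> bool"
  where "shuffle_hom h \<longleftrightarrow> linear h \<and> h 1 = word [] \<and> (\<forall>p q. h (p * q) = shuffle (h p) (h q))"

text \<open>
  The homomorphism exists because the shuffle product is commutative and associative with unit
  \<open>word []\<close>, and it is unique because the variables generate the polynomial ring.
\<close>

definition poly_to_tensor :: "'d poly_ring \<Rightarrow> 'd tensor"
  where "poly_to_tensor = (THE h. shuffle_hom h \<and> (\<forall>j. h (poly_var j) = word [j]))"

definition M_map :: "('t::finite \<Rightarrow> 'd poly_ring) \<Rightarrow> 't tensor \<Rightarrow> 'd tensor"
  where "M_map p = Lambda (\<lambda>v. \<Sum>i\<in>UNIV. (v $ i) *\<^sub>R poly_to_tensor (p i))"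

section \<open>Paths and signatures\<close>

text \<open>
  The increment of a function over a closed interval \<open>K\<close> is taken between \<open>Inf K\<close> and \<open>Sup K\<close>.
  Degenerate intervals are permitted in divisions and contribute 0 to all sums below.
\<close>

definition finite_variation :: "real \<Rightarrow> real \<Rightarrow> (real \<Rightarrow> 'a::real_normed_vector) \<Rightarrow> bool"
  where "finite_variation q T X \<longleftrightarrow>
    bdd_above {\<Sum>K\<in>D. norm (X (Sup K) - X (Inf K)) powr q | D. D division_of {0..T}}"

text \<open>
  A path is a pair of its end time and a function, which is \<open>undefined\<close> off the time interval
  in order that equality of pairs is equality of functions on the time interval.
\<close>

type_synonym 'd path_fun = "real \<times> (real \<Rightarrow> real ^ 'd)"

definition paths :: "('d::finite) path_fun set"
  where "paths = {(T, X). 0 < T \<and> X \<in> extensional {0..T} \<and> continuous_on {0..T} X \<and>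
    (\<exists>q. 1 \<le> q \<and> q < 2 \<and> finite_variation q T X)}"

definition has_RS_integral ::
  "(real \<Rightarrow> real) \<Rightarrow> (real \<Rightarrow> real) \<Rightarrow> real \<Rightarrow> real \<Rightarrow> real \<Rightarrow> bool"
  where "has_RS_integral f g a b I \<longleftrightarrow>
    (\<forall>\<epsilon>>0. \<exists>\<delta>>0. \<forall>D. D tagged_division_of {a..b} \<and> (\<forall>(x, K)\<in>D. Sup K - Inf K < \<delta>) \<longrightarrow>
      \<bar>(\<Sum>(x, K)\<in>D. f x * (g (Sup K) - g (Inf K))) - I\<bar> < \<epsilon>)"

definition RS_integral :: "(real \<Rightarrow> real) \<Rightarrow> (real \<Rightarrow> real) \<Rightarrow> real \<Rightarrow> real \<Rightarrow> real"
  where "RS_integral f g a b = (THE I. has_RS_integral f g a b I)"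

text \<open>
  The last letter of a word belongs to the outermost integral; the first argument
  list is the word in reversed order.
\<close>

primrec iterated_integral_rev :: "'d list \<Rightarrow> (real \<Rightarrow> real ^ 'd) \<Rightarrow> real \<Rightarrow> real"
  where
    "iterated_integral_rev [] X s = 1"
  | "iterated_integral_rev (i # w) X s =
      RS_integral (\<lambda>r. iterated_integral_rev w X r) (\<lambda>r. X r $ i) 0 s"

definition signature :: "('d::finite) path_fun \<Rightarrow> 'd dual_tensor"
  where "signature X = (\<lambda>w. iterated_integral_rev (rev w) (snd X) (fst X))"

definition stopped :: "real \<Rightarrow> ('d::finite) path_fun \<Rightarrow> 'd path_fun"
  where "stopped s X = (s, restrict (snd X) {0..s})"

text \<open>The convention for the signature of a path stopped at time 0 holds automatically.\<close>

lemma signature_stopped_0: "signature (stopped 0 X) w = (if w = [] then 1 else 0)"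
proof -
  have "RS_integral f g 0 0 = 0" for f g :: "real \<Rightarrow> real"
  proof -
    define P where "P = (\<lambda>(\<delta>::real) D. D tagged_division_of {0..0::real} \<and> (\<forall>(x, K)\<in>D. Sup K - Inf K < \<delta>))"
    define S where "S = (\<lambda>D. \<Sum>(x, K)\<in>D. f x * (g (Sup K) - g (Inf K)))"
    have iff: "has_RS_integral f g 0 0 I \<longleftrightarrow> (\<forall>\<epsilon>>0. \<exists>\<delta>>0. \<forall>D. P \<delta> D \<longrightarrow> \<bar>S D - I\<bar> < \<epsilon>)" for I
      unfolding has_RS_integral_def P_def S_def by (rule refl)
    have zero: "S D = 0" if "P \<delta> D" for \<delta> D
      unfolding S_def
    proof (rule sum.neutral, clarify)
      have D: "D tagged_division_of {0..0}"
        using that unfolding P_def by (rule conjunct1)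
      fix x K assume "(x, K) \<in> D"
      then have "K = {0}"
        using tagged_division_ofD(2,3)[OF D]
        by (metis atLeastAtMost_singleton empty_iff subset_singletonD)
      then show "f x * (g (Sup K) - g (Inf K)) = 0" by simp
    qed
    have ex: "P \<delta> {(0, {0..0})}" if "\<delta> > 0" for \<delta>
      using tagged_division_of_self_real[of 0 "0::real" 0] that by (simp add: P_def)
    have eq: "has_RS_integral f g 0 0 I \<longleftrightarrow> I = 0" for I
    proof
      assume I: "has_RS_integral f g 0 0 I"
      show "I = 0"
      proof (rule ccontr)
        assume "I \<noteq> 0"
        then have "\<bar>I\<bar> > 0" by simp
        then obtain \<delta> where "\<delta> > 0" "\<forall>D. P \<delta> D \<longrightarrow> \<bar>S D - I\<bar> < \<bar>I\<bar>"
          using I unfolding iff by blast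
        then show False
          using zero ex by force
      qed
    next
      assume "I = 0"
      then show "has_RS_integral f g 0 0 I"
        unfolding iff using zero zero_less_one by fastforce
    qed
    show ?thesis
      unfolding RS_integral_def eq by (rule the_eq_trivial)
  qed
  then show ?thesis
    by (cases "rev w") (simp_all add: signature_def stopped_def)
qed

section \<open>Path varieties\<close>

definition variety :: "('d::finite) tensor set \<Rightarrow> 'd path_fun set"
  where "variety W = {X \<in> paths. \<forall>x\<in>W. pairing (signature X) x = 0}"

definition vanishing :: "('d::finite) path_fun set \<Rightarrow> 'd tensor set"
  where "vanishing M = {x. \<forall>X\<in>M. pairing (signature X) x = 0}"

definition path_variety :: "('d::finite) path_fun set \<Rightarrow> bool"
  where "path_variety V \<longleftrightarrow> (\<exists>W. V = variety W)"

definition poly_path :: "('t::finite \<Rightarrow> ('d::finite) poly_ring) \<Rightarrow> 'd path_fun \<Rightarrow> 't path_fun"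
  where "poly_path p X =
    (fst X, restrict (\<lambda>s. poly_map p (snd X s - snd X 0)) {0..fst X})"

definition Lambda_star :: "(real ^ ('t::finite) \<Rightarrow> ('d::finite) tensor) \<Rightarrow> 'd path_fun \<Rightarrow> 't path_fun"
  where "Lambda_star B X =
    (fst X, restrict (\<lambda>s. \<chi> i. pairing (signature (stopped s X)) (B (axis i 1))) {0..fst X})"

end

theory Submission
  imports Defs
begin

text \<open>
  A path of finite \<open>q\<close>-variation admits a monotone \<open>V\<close> with increments bounded by
  \<open>(V b - V a) powr (1 / q)\<close>. On the functions with such a control, the integral \<open>F\<close> of \<open>f\<close>
  against \<open>g\<close> is characterised by \<open>F 0 = 0\<close> and \<open>F b - F a - f x * (g b - g a)\<close> being small
  compared with \<open>V b - V a\<close> on short intervals. From this description, associativity and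
  integration by parts are immediate, so that the halfshuffle of two words is sent by the signature
  to the integral of one coordinate against the other. Hence the iterated integrals of
  \<open>Lambda_star B X\<close> are the coordinates of the signature of \<open>X\<close> at the images of
  words under \<open>Lambda B\<close>, and the pullback of a variety is cut out by \<open>Lambda B\<close> of its
  vanishing ideal. Since the signature is a character of the shuffle algebra, the polynomial
  maps are the case \<open>B i = poly_to_tensor (p i)\<close>.
\<close>

section \<open>Young integration\<close>

text \<open>The integral is defined by \<open>THE\<close> as a limit over all tagged divisions of
  small mesh with arbitrary tags, whereas left-point sums on uniform grids only produce a candidate
  value. The bridge is that \<open>primitive\<close> admits any tag and measures its error by
  increments of one monotone function, which telescope over every division. The bound q < 2 enters
  as \<alpha> = 1/q > 1/2: a product of an increment of f and one of g has order 2\<alpha> > 1 in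
  the control. All coordinates of the path and all its iterated integrals share one V and one
  \<alpha>. Integration stays in this class, which allows iteration and also makes
  \<open>Lambda_star B X\<close> a path again, of finite (1/\<alpha>)-variation. On the algebraic
  side, iterated integrals of nonempty words vanish at time 0. Hence integration by parts has no
  boundary term and turns a product into a sum of two halfshuffles; values of B in
  \<open>tensor_ge1\<close> are what makes \<open>Lambda_star B X\<close> start at the
  origin.\<close>

lemma young_sum:
  fixes f g V :: "real \<Rightarrow> real"
  assumes \<theta>: "\<theta> > 1" and M: "M \<ge> 0" and V: "mono_on {a..b} V"
    and H: "\<And>a' b' x y z w. a \<le> a' \<Longrightarrow> b' \<le> b \<Longrightarrow> {x, y, z, w} \<subseteq> {a'..b'} \<Longrightarrow>
      \<bar>f x - f y\<bar> * \<bar>g z - g w\<bar> \<le> M * (V b' - V a') powr \<theta>"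
    and t: "mono t" "a \<le> t m" "t (m + n) \<le> b"
  shows "\<bar>(\<Sum>i=m..<m+n. f (t i) * (g (t (Suc i)) - g (t i))) - f (t m) * (g (t (m + n)) - g (t m))\<bar>
    \<le> 2 / (1 - 2 powr (1 - \<theta>)) * M * (V (t (m + n)) - V (t m)) powr \<theta>"
  using t
proof (induction n arbitrary: m rule: less_induct)
  case (less n)
  \<comment> \<open>C is the solution of C = 2 + C * 2 powr (1 - \<theta>): in the induction both
    halves of the control contribute C * (\<omega>/2) powr \<theta>, and the two changes of tag
    contribute 1 each.\<close>
  define C where "C = 2 / (1 - 2 powr (1 - \<theta>))"
  have p1: "2 powr (1 - \<theta>) < 1" using \<theta> by (simp add: powr_less_one)
  define u where "u = (2 :: real) powr (1 - \<theta>)"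
  have C0: "C > 0" and C: "2 + C * 2 powr (1 - \<theta>) = C"
  proof -
    have "1 - u > 0" using p1 by (simp add: u_def)
    then show "C > 0" unfolding C_def u_def[symmetric] by (rule divide_pos_pos[rotated]) simp
    have "C * (1 - u) = 2" unfolding C_def u_def[symmetric]
      by (rule nonzero_eq_divide_eq[THEN iffD1, OF _ refl]) (use \<open>1 - u > 0\<close> in simp)
    then show "2 + C * 2 powr (1 - \<theta>) = C"
      unfolding u_def[symmetric] right_diff_distrib by linarith
  qed
  define S where "S = (\<lambda>l h. \<Sum>i=l..<h. f (t i) * (g (t (Suc i)) - g (t i)))"
  define \<omega> where "\<omega> = V (t (m + n)) - V (t m)"
  have tm: "t i \<le> t j" if "i \<le> j" for i j using less.prems(1) that by (rule monoD)
  have inab: "t i \<in> {a..b}" if "m \<le> i" "i \<le> m + n" for i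
    using tm[OF that(1)] tm[OF that(2)] less.prems by auto
  have Vm: "V (t i) \<le> V (t j)" if "m \<le> i" "i \<le> j" "j \<le> m + n" for i j
    using V inab[of i] inab[of j] tm[of i j] that by (auto simp: mono_on_def)
  have \<omega>0: "\<omega> \<ge> 0" using Vm[of m "m+n"] by (simp add: \<omega>_def)
  show ?case
  proof (cases "n = 0")
    case True
    then show ?thesis by simp
  next
    case False
    \<comment> \<open>The cut halves the control, not the index range: k is the last index with at
      most \<omega>/2 to its left. By maximality at most \<omega>/2 lies to the right of
      \<open>Suc k\<close>; the single step between them, over which V may jump, stays one
      summand.\<close>
    define Q where "Q = (\<lambda>k. k < n \<and> V (t (m + k)) - V (t m) \<le> \<omega> / 2)"
    define k where "k = (GREATEST k. Q k)"
    have "Q 0" using False \<omega>0 by (simp add: Q_def)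
    then have Qk: "Q k" unfolding k_def by (rule GreatestI_nat[where b = n]) (simp add: Q_def)
    have Qmax: "j \<le> k" if "Q j" for j
      unfolding k_def using that by (rule Greatest_le_nat[where b = n]) (simp add: Q_def)
    have kn: "k < n" and left: "V (t (m + k)) - V (t m) \<le> \<omega> / 2" using Qk by (auto simp: Q_def)
    have right: "V (t (m + n)) - V (t (m + Suc k)) \<le> \<omega> / 2"
    proof (cases "Suc k = n")
      case True
      then show ?thesis using \<omega>0 by simp
    next
      case False
      then have "\<not> Q (Suc k)" using Qmax[of "Suc k"] by auto
      then show ?thesis using False kn unfolding Q_def \<omega>_def by (auto simp: field_simps)
    qed
    have half: "(\<omega> / 2) powr \<theta> = 2 powr (- \<theta>) * \<omega> powr \<theta>"
      using \<omega>0 by (simp add: powr_divide powr_minus divide_simps)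
    have e1: "\<bar>S m (m + k) - f (t m) * (g (t (m + k)) - g (t m))\<bar> \<le> C * M * (\<omega> / 2) powr \<theta>"
    proof -
      have "\<bar>S m (m + k) - f (t m) * (g (t (m + k)) - g (t m))\<bar>
          \<le> C * M * (V (t (m + k)) - V (t m)) powr \<theta>"
        unfolding S_def C_def using less.IH[OF kn less.prems(1), of m] less.prems inab[of "m+k"] kn by auto
      also have "\<dots> \<le> C * M * (\<omega> / 2) powr \<theta>"
        using left Vm[of m "m+k"] kn C0 M \<theta> by (intro mult_left_mono powr_mono2) auto
      finally show ?thesis .
    qed
    define l where "l = m + Suc k"
    have ln: "m + n = l + (n - Suc k)" using kn by (simp add: l_def)
    have e2: "\<bar>S l (m + n) - f (t l) * (g (t (m + n)) - g (t l))\<bar> \<le> C * M * (\<omega> / 2) powr \<theta>"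
    proof -
      have "\<bar>S l (m + n) - f (t l) * (g (t (m + n)) - g (t l))\<bar>
          \<le> C * M * (V (t (m + n)) - V (t l)) powr \<theta>"
      proof -
        have "n - Suc k < n" "a \<le> t l" "t (l + (n - Suc k)) \<le> b"
          using inab[of l] kn less.prems by (auto simp: l_def)
        from less.IH[OF this(1) less.prems(1) this(2,3)] show ?thesis
          unfolding S_def C_def ln[symmetric] .
      qed
      also have "\<dots> \<le> C * M * (\<omega> / 2) powr \<theta>"
        using right Vm[of l "m+n"] kn C0 M \<theta> by (intro mult_left_mono powr_mono2) (auto simp: l_def)
      finally show ?thesis .
    qed
    have pts: "t (m + k) \<in> {t m..t (m + n)}" "t l \<in> {t m..t (m + n)}" "t m \<in> {t m..t (m + n)}"
        "t (m + n) \<in> {t m..t (m + n)}"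
      using tm kn by (auto simp: l_def)
    \<comment> \<open>Moving the tags of the middle step and of the right part to \<open>t m\<close>
      costs one product of increments each.\<close>
    have e3: "\<bar>f (t (m + k)) - f (t m)\<bar> * \<bar>g (t l) - g (t (m + k))\<bar> \<le> M * \<omega> powr \<theta>"
      unfolding \<omega>_def using pts less.prems by (intro H) auto
    have e4: "\<bar>f (t l) - f (t m)\<bar> * \<bar>g (t (m + n)) - g (t l)\<bar> \<le> M * \<omega> powr \<theta>"
      unfolding \<omega>_def using pts less.prems by (intro H) auto
    have "S m (m + n) = S m (m + k) + S (m + k) (m + n)"
      unfolding S_def using kn by (simp add: sum.atLeastLessThan_concat)
    also have "S (m + k) (m + n) = f (t (m + k)) * (g (t l) - g (t (m + k))) + S l (m + n)"
      unfolding S_def l_def using kn by (simp add: sum.atLeast_Suc_lessThan)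
    finally have "S m (m + n) - f (t m) * (g (t (m + n)) - g (t m)) =
        (S m (m + k) - f (t m) * (g (t (m + k)) - g (t m))) +
        (S l (m + n) - f (t l) * (g (t (m + n)) - g (t l))) +
        (f (t (m + k)) - f (t m)) * (g (t l) - g (t (m + k))) +
        (f (t l) - f (t m)) * (g (t (m + n)) - g (t l))"
      by (simp add: algebra_simps)
    then have "\<bar>S m (m + n) - f (t m) * (g (t (m + n)) - g (t m))\<bar> \<le>
        \<bar>S m (m + k) - f (t m) * (g (t (m + k)) - g (t m))\<bar> +
        \<bar>S l (m + n) - f (t l) * (g (t (m + n)) - g (t l))\<bar> +
        \<bar>f (t (m + k)) - f (t m)\<bar> * \<bar>g (t l) - g (t (m + k))\<bar> +
        \<bar>f (t l) - f (t m)\<bar> * \<bar>g (t (m + n)) - g (t l)\<bar>"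
      unfolding abs_mult[symmetric] by linarith
    also have "\<dots> \<le> 2 * (C * M * (\<omega> / 2) powr \<theta>) + 2 * (M * \<omega> powr \<theta>)"
      using e1 e2 e3 e4 by linarith
    also have "\<dots> = (2 + C * 2 powr (1 - \<theta>)) * M * \<omega> powr \<theta>"
    proof -
      define u v where "u = (2 :: real) powr (- \<theta>)" and "v = \<omega> powr \<theta>"
      have two: "2 powr (1 - \<theta>) = 2 * u" unfolding u_def using powr_add[of 2 1 "- \<theta>"] by simp
      show ?thesis unfolding half two u_def[symmetric] v_def[symmetric] by algebra
    qed
    also have "\<dots> = C * M * \<omega> powr \<theta>" by (simp only: C)
    finally show ?thesis unfolding S_def \<omega>_def C_def .
  qed
qed

section \<open>Controlled functions and primitives\<close>

locale young =
  fixes T \<alpha> :: real and V :: "real \<Rightarrow> real"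
  assumes T: "T > 0" and V: "mono_on {0..T} V" and \<alpha>: "1 / 2 < \<alpha>" "\<alpha> \<le> 1"
begin

text \<open>V may jump, so the bound does not give continuity, which is therefore a clause of its
  own.\<close>

definition controlled :: "(real \<Rightarrow> real) \<Rightarrow> bool"
  where "controlled f \<longleftrightarrow> continuous_on {0..T} f \<and>
    (\<exists>K\<ge>0. \<forall>a b. 0 \<le> a \<longrightarrow> a \<le> b \<longrightarrow> b \<le> T \<longrightarrow> \<bar>f b - f a\<bar> \<le> K * (V b - V a) powr \<alpha>)"

text \<open>The arbitrary tag x matches the tags in \<open>has_RS_integral\<close>, and it can be
  set to either end of the interval for integration by parts. Nothing is asked of f and g, so the
  algebraic rules hold without regularity.\<close>

definition primitive :: "(real \<Rightarrow> real) \<Rightarrow> (real \<Rightarrow> real) \<Rightarrow> (real \<Rightarrow> real) \<Rightarrow> bool"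
  where "primitive f g F \<longleftrightarrow> F 0 = 0 \<and> (\<forall>\<epsilon>>0. \<exists>\<delta>>0. \<forall>a x b.
    0 \<le> a \<longrightarrow> a \<le> x \<longrightarrow> x \<le> b \<longrightarrow> b \<le> T \<longrightarrow> b - a < \<delta> \<longrightarrow>
      \<bar>F b - F a - f x * (g b - g a)\<bar> \<le> \<epsilon> * (V b - V a))"

lemma VD: "0 \<le> a \<Longrightarrow> a \<le> b \<Longrightarrow> b \<le> T \<Longrightarrow> V a \<le> V b"
  using V by (auto simp: mono_on_def)

lemma controlled_continuous: "controlled f \<Longrightarrow> continuous_on {0..T} f"
  by (simp add: controlled_def)

text \<open>Monotonicity of V extends the bound from end points to inner points. Passing from K to K
  + 1 makes the constant positive, so that \<open>pair_small\<close> can divide by it.\<close>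

lemma controlled_bound:
  assumes "controlled f"
  obtains K where "K > 0"
    "\<And>a b x y. 0 \<le> a \<Longrightarrow> b \<le> T \<Longrightarrow> x \<in> {a..b} \<Longrightarrow> y \<in> {a..b} \<Longrightarrow> \<bar>f x - f y\<bar> \<le> K * (V b - V a) powr \<alpha>"
proof -
  obtain K where K: "K \<ge> 0"
    "\<And>a b. 0 \<le> a \<Longrightarrow> a \<le> b \<Longrightarrow> b \<le> T \<Longrightarrow> \<bar>f b - f a\<bar> \<le> K * (V b - V a) powr \<alpha>"
    using assms unfolding controlled_def by blast
  have *: "\<bar>f y - f x\<bar> \<le> (K + 1) * (V b - V a) powr \<alpha>"
    if "0 \<le> a" "b \<le> T" "x \<in> {a..b}" "y \<in> {a..b}" "x \<le> y" for a b x y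
  proof -
    have "\<bar>f y - f x\<bar> \<le> K * (V y - V x) powr \<alpha>" using K(2)[of x y] that by auto
    also have "\<dots> \<le> K * (V b - V a) powr \<alpha>"
      using that VD[of a x] VD[of y b] VD[of x y] K(1) \<alpha>
      by (intro mult_left_mono powr_mono2) auto
    also have "\<dots> \<le> (K + 1) * (V b - V a) powr \<alpha>" by (simp add: mult_right_mono)
    finally show ?thesis .
  qed
  have "\<bar>f x - f y\<bar> \<le> (K + 1) * (V b - V a) powr \<alpha>"
    if "0 \<le> a" "b \<le> T" "x \<in> {a..b}" "y \<in> {a..b}" for a b x y
    using *[of a b x y] *[of a b y x] that by (cases "x \<le> y") (auto simp: abs_minus_commute)
  then show thesis using that[of "K + 1"] K(1) by auto
qed

lemma continuous_bound:
  assumes "continuous_on {0..T} (f :: real \<Rightarrow> real)"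
  obtains B where "B > 0" "\<And>x. x \<in> {0..T} \<Longrightarrow> \<bar>f x\<bar> \<le> B"
proof -
  have "bounded (f ` {0..T})" using assms by (intro compact_imp_bounded compact_continuous_image) auto
  then obtain B where "B > 0" "\<forall>y\<in>f ` {0..T}. norm y \<le> B" unfolding bounded_pos by blast
  then show thesis using that[of B] by auto
qed

lemma continuous_osc:
  assumes "continuous_on {0..T} (f :: real \<Rightarrow> real)" "\<eta> > 0"
  obtains \<delta> where "\<delta> > 0" "\<And>x y. x \<in> {0..T} \<Longrightarrow> y \<in> {0..T} \<Longrightarrow> \<bar>x - y\<bar> < \<delta> \<Longrightarrow> \<bar>f x - f y\<bar> < \<eta>"
proof -
  have "uniformly_continuous_on {0..T} f" using assms by (intro compact_uniformly_continuous) auto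
  then obtain \<delta> where "\<delta> > 0" "\<forall>x\<in>{0..T}. \<forall>y\<in>{0..T}. dist y x < \<delta> \<longrightarrow> dist (f y) (f x) < \<eta>"
    unfolding uniformly_continuous_on_def using assms(2) by blast
  then show thesis using that[of \<delta>] by (auto simp: dist_real_def)
qed

text \<open>The midpoint of 1 and 2\<alpha>: above 1, as \<open>young_sum\<close> requires, and
  below 2\<alpha>, which leaves room for a small constant.\<close>

abbreviation (input) \<theta> :: real where "\<theta> \<equiv> \<alpha> + 1 / 2"

lemma powr_omega_le:
  assumes "0 \<le> a" "a \<le> b" "b \<le> T" "0 < r" "r \<le> s"
  shows "(V b - V a) powr s \<le> (V T - V 0) powr (s - r) * (V b - V a) powr r"
proof -
  have "(V b - V a) powr s = (V b - V a) powr (s - r) * (V b - V a) powr r"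
    by (simp add: powr_add[symmetric])
  also have "\<dots> \<le> (V T - V 0) powr (s - r) * (V b - V a) powr r"
    using assms VD[of 0 a] VD[of a b] VD[of b T] by (intro mult_right_mono powr_mono2) auto
  finally show ?thesis .
qed

text \<open>
  Interpolating between the oscillation of \<open>f\<close> and its control leaves an exponent above 1 and a
  small constant, so the control itself need not be continuous.
\<close>

lemma pair_small:
  assumes f: "controlled f" and g: "controlled g" and \<epsilon>: "\<epsilon> > 0"
  obtains \<delta> where "\<delta> > 0" "\<And>a b x y z w. 0 \<le> a \<Longrightarrow> b \<le> T \<Longrightarrow> b - a < \<delta> \<Longrightarrow>
    {x, y, z, w} \<subseteq> {a..b} \<Longrightarrow> \<bar>f x - f y\<bar> * \<bar>g z - g w\<bar> \<le> \<epsilon> * (V b - V a) powr \<theta>"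
proof -
  obtain K where K: "K > 0" "\<And>a b x y. 0 \<le> a \<Longrightarrow> b \<le> T \<Longrightarrow> x \<in> {a..b} \<Longrightarrow> y \<in> {a..b} \<Longrightarrow>
      \<bar>f x - f y\<bar> \<le> K * (V b - V a) powr \<alpha>" using controlled_bound[OF f] by blast
  obtain L where L: "L > 0" "\<And>a b x y. 0 \<le> a \<Longrightarrow> b \<le> T \<Longrightarrow> x \<in> {a..b} \<Longrightarrow> y \<in> {a..b} \<Longrightarrow>
      \<bar>g x - g y\<bar> \<le> L * (V b - V a) powr \<alpha>" using controlled_bound[OF g] by blast
  \<comment> \<open>The oscillation of f enters with power r and its control with power 1 - r; r is
    fixed by \<alpha> * (1 - r) + \<alpha> = \<theta>.\<close>
  define r where "r = (\<alpha> - 1 / 2) / \<alpha>"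
  have r: "0 < r" "r < 1" using \<alpha> by (auto simp: r_def field_simps)
  have r\<theta>: "\<alpha> * (1 - r) + \<alpha> = \<theta>" using \<alpha> by (simp add: r_def field_simps)
  define \<eta> where "\<eta> = (\<epsilon> / (K powr (1 - r) * L)) powr (1 / r)"
  have \<eta>: "\<eta> > 0" and \<eta>r: "\<eta> powr r * K powr (1 - r) * L = \<epsilon>"
    using \<epsilon> K(1) L(1) r by (auto simp: \<eta>_def powr_powr)
  obtain \<delta> where \<delta>: "\<delta> > 0"
    "\<And>x y. x \<in> {0..T} \<Longrightarrow> y \<in> {0..T} \<Longrightarrow> \<bar>x - y\<bar> < \<delta> \<Longrightarrow> \<bar>f x - f y\<bar> < \<eta>"
    using continuous_osc[OF controlled_continuous[OF f] \<eta>] by blast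
  show thesis
  proof (rule that[OF \<delta>(1)])
    fix a b x y z w :: real
    assume *: "0 \<le> a" "b \<le> T" "b - a < \<delta>" "{x, y, z, w} \<subseteq> {a..b}"
    have osc: "\<bar>f x - f y\<bar> \<le> \<eta>" using * by (intro less_imp_le \<delta>(2)) auto
    have "\<bar>f x - f y\<bar> = \<bar>f x - f y\<bar> powr r * \<bar>f x - f y\<bar> powr (1 - r)"
      by (simp add: powr_add[symmetric])
    also have "\<dots> \<le> \<eta> powr r * (K * (V b - V a) powr \<alpha>) powr (1 - r)"
      using * r osc K(2)[of a b x y] by (intro mult_mono powr_mono2) auto
    also have "\<dots> = \<eta> powr r * K powr (1 - r) * (V b - V a) powr (\<alpha> * (1 - r))"
      using K(1) by (simp add: powr_mult powr_powr)
    finally have "\<bar>f x - f y\<bar> * \<bar>g z - g w\<bar> \<le>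
        \<eta> powr r * K powr (1 - r) * (V b - V a) powr (\<alpha> * (1 - r)) * (L * (V b - V a) powr \<alpha>)"
      using * L(2)[of a b z w] by (intro mult_mono) auto
    also have "\<dots> = \<epsilon> * (V b - V a) powr \<theta>"
      unfolding r\<theta>[symmetric] powr_add \<eta>r[symmetric] by (simp add: mult_ac)
    finally show "\<bar>f x - f y\<bar> * \<bar>g z - g w\<bar> \<le> \<epsilon> * (V b - V a) powr \<theta>" .
  qed
qed

text \<open>The counterpart of \<open>pair_small\<close> for intervals of any length. Its constant
  is not small, but it suffices to show that an integral is \<open>controlled\<close> again.\<close>

lemma pair_global:
  assumes f: "controlled f" and g: "controlled g"
  obtains M where "M \<ge> 0" "\<And>a b x y z w. 0 \<le> a \<Longrightarrow> b \<le> T \<Longrightarrow>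
    {x, y, z, w} \<subseteq> {a..b} \<Longrightarrow> \<bar>f x - f y\<bar> * \<bar>g z - g w\<bar> \<le> M * (V b - V a) powr \<theta>"
proof -
  obtain K where K: "K > 0" "\<And>a b x y. 0 \<le> a \<Longrightarrow> b \<le> T \<Longrightarrow> x \<in> {a..b} \<Longrightarrow> y \<in> {a..b} \<Longrightarrow>
      \<bar>f x - f y\<bar> \<le> K * (V b - V a) powr \<alpha>" using controlled_bound[OF f] by blast
  obtain L where L: "L > 0" "\<And>a b x y. 0 \<le> a \<Longrightarrow> b \<le> T \<Longrightarrow> x \<in> {a..b} \<Longrightarrow> y \<in> {a..b} \<Longrightarrow>
      \<bar>g x - g y\<bar> \<le> L * (V b - V a) powr \<alpha>" using controlled_bound[OF g] by blast
  show thesis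
  proof (rule that[of "K * L * (V T - V 0) powr (\<alpha> + \<alpha> - \<theta>)"])
    fix a b x y z w :: real
    assume *: "0 \<le> a" "b \<le> T" "{x, y, z, w} \<subseteq> {a..b}"
    have "\<bar>f x - f y\<bar> * \<bar>g z - g w\<bar> \<le> (K * (V b - V a) powr \<alpha>) * (L * (V b - V a) powr \<alpha>)"
      using * K(2)[of a b x y] L(2)[of a b z w] K(1) by (intro mult_mono) auto
    also have "\<dots> = K * L * (V b - V a) powr (\<alpha> + \<alpha>)" unfolding powr_add by (simp only: mult_ac)
    also have "\<dots> \<le> K * L * ((V T - V 0) powr (\<alpha> + \<alpha> - \<theta>) * (V b - V a) powr \<theta>)"
      using * \<alpha> K(1) L(1) by (intro mult_left_mono powr_omega_le) auto
    finally show "\<bar>f x - f y\<bar> * \<bar>g z - g w\<bar> \<le>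
        K * L * (V T - V 0) powr (\<alpha> + \<alpha> - \<theta>) * (V b - V a) powr \<theta>"
      by (simp add: mult_ac)
  qed (use K(1) L(1) in auto)
qed

section \<open>Left sums on uniform grids and their limit\<close>

definition grid :: "nat \<Rightarrow> nat \<Rightarrow> real"
  where "grid N i = real i * T / real N"

text \<open>One grid on \<open>{0..T}\<close> serves every s, since the cells to the right of s
  contribute g s - g s = 0. Values at different s can then be subtracted cell by cell.\<close>

definition left_sum :: "(real \<Rightarrow> real) \<Rightarrow> (real \<Rightarrow> real) \<Rightarrow> nat \<Rightarrow> real \<Rightarrow> real"
  where "left_sum f g N s =
    (\<Sum>i<N. f (grid N i) * (g (min s (grid N (Suc i))) - g (min s (grid N i))))"

lemma grid_mono: "i \<le> j \<Longrightarrow> grid N i \<le> grid N j"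
  using T by (simp add: grid_def divide_right_mono mult_right_mono)

lemma grid_nonneg: "0 \<le> grid N i"
  using T by (simp add: grid_def)

lemma grid_le: "i \<le> N \<Longrightarrow> grid N i \<le> T"
  using T by (cases "N = 0") (auto simp: grid_def field_simps)

lemma grid_last: "N > 0 \<Longrightarrow> grid N N = T"
  by (simp add: grid_def)

lemma grid_step: "grid N (Suc i) - grid N i = T / N"
  by (simp add: grid_def field_simps add_divide_distrib)

text \<open>The grid projected to \<open>{a..b}\<close>: a partition of that interval with repeated
  points, which \<open>young_sum\<close> admits because it asks only for monotone t.\<close>

definition clamped :: "real \<Rightarrow> real \<Rightarrow> nat \<Rightarrow> nat \<Rightarrow> real"
  where "clamped a b N i = max a (min b (grid N i))"

text \<open>Only the cell of the grid with \<open>a\<close> in its interior has its left end moved by clamping.\<close>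

lemma left_sum_clamped:
  assumes f: "continuous_on {0..T} f" and g: "continuous_on {0..T} g" and \<eta>: "\<eta> > 0"
  shows "\<exists>N0. \<forall>N\<ge>N0. \<forall>a b. 0 \<le> a \<longrightarrow> a \<le> b \<longrightarrow> b \<le> T \<longrightarrow>
    \<bar>left_sum f g N b - left_sum f g N a -
      (\<Sum>i<N. f (clamped a b N i) * (g (clamped a b N (Suc i)) - g (clamped a b N i)))\<bar> \<le> \<eta>"
proof -
  obtain B where B: "B > 0" "\<And>x. x \<in> {0..T} \<Longrightarrow> \<bar>g x\<bar> \<le> B" using continuous_bound[OF g] by blast
  obtain \<delta> where \<delta>: "\<delta> > 0"
    "\<And>x y. x \<in> {0..T} \<Longrightarrow> y \<in> {0..T} \<Longrightarrow> \<bar>x - y\<bar> < \<delta> \<Longrightarrow> \<bar>f x - f y\<bar> < \<eta> / (2 * B)"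
    using continuous_osc[OF f, of "\<eta> / (2 * B)"] B(1) \<eta> by auto
  obtain N0 where N0: "T / \<delta> < real N0" using reals_Archimedean2 by blast
  show ?thesis
  proof (intro exI[of _ N0] allI impI)
    fix N a b assume N: "N0 \<le> N" and ab: "0 \<le> a" "a \<le> b" "b \<le> T"
    have "0 < T / \<delta>" using T \<delta>(1) by simp
    then have Npos: "N > 0" using N0 N by (cases N) auto
    have "T / \<delta> < real N" using N0 N by linarith
    then have step: "T / N < \<delta>" using \<delta>(1) Npos by (simp add: field_simps)
    define c where "c = clamped a b N"
    have c: "c i \<in> {a..b}" for i using ab by (auto simp: c_def clamped_def)
    \<comment> \<open>The only cell that can contribute: a lies strictly inside it. There the
      oscillation \<eta> / (2 * B) of f meets an increment of g of at most 2 * B.\<close>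
    define k where "k = nat \<lfloor>a * N / T\<rfloor>"
    have gd: "(g (min b (grid N (Suc i))) - g (min b (grid N i))) -
        (g (min a (grid N (Suc i))) - g (min a (grid N i))) = g (c (Suc i)) - g (c i)" for i
      using ab by (auto simp: c_def clamped_def min_def max_def)
    have "left_sum f g N b - left_sum f g N a = (\<Sum>i<N. f (grid N i) * (g (c (Suc i)) - g (c i)))"
      unfolding left_sum_def sum_subtractf[symmetric] right_diff_distrib[symmetric] gd ..
    then have "\<bar>left_sum f g N b - left_sum f g N a - (\<Sum>i<N. f (c i) * (g (c (Suc i)) - g (c i)))\<bar>
        = \<bar>\<Sum>i<N. (f (grid N i) - f (c i)) * (g (c (Suc i)) - g (c i))\<bar>"
      by (simp add: sum_subtractf[symmetric] left_diff_distrib)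
    also have "\<dots> \<le> (\<Sum>i<N. \<bar>(f (grid N i) - f (c i)) * (g (c (Suc i)) - g (c i))\<bar>)"
      by (rule sum_abs)
    also have "\<dots> \<le> (\<Sum>i<N. if i = k then \<eta> else 0)"
    proof (rule sum_mono)
      fix i assume i: "i \<in> {..<N}"
      \<comment> \<open>In the first and third case the clamped cell is a point, in the second its
        left end is the grid point itself; only the last case leaves a difference of tags.\<close>
      consider "grid N (Suc i) \<le> a" | "a \<le> grid N i" "grid N i \<le> b" | "b \<le> grid N i"
        | "grid N i < a" "a < grid N (Suc i)" by linarith
      then show "\<bar>(f (grid N i) - f (c i)) * (g (c (Suc i)) - g (c i))\<bar> \<le> (if i = k then \<eta> else 0)"
      proof cases
        case 1
        then have "c (Suc i) = c i" using grid_mono[of i "Suc i" N] ab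
          by (auto simp: c_def clamped_def min_def max_def)
        then show ?thesis using \<eta> by simp
      next
        case 2
        then have "c i = grid N i" by (auto simp: c_def clamped_def min_def max_def)
        then show ?thesis using \<eta> by simp
      next
        case 3
        then have "c (Suc i) = c i" using grid_mono[of i "Suc i" N] ab
          by (auto simp: c_def clamped_def min_def max_def)
        then show ?thesis using \<eta> by simp
      next
        case 4
        then have "real i < a * N / T" "a * N / T < real i + 1"
          using T Npos by (auto simp: grid_def field_simps)
        then have "\<lfloor>a * N / T\<rfloor> = int i" by (intro floor_unique) auto
        then have ik: "i = k" by (simp add: k_def)
        have "\<bar>grid N i - c i\<bar> < \<delta>"
          using 4 ab step grid_step[of N i] by (auto simp: c_def clamped_def min_def max_def)
        then have "\<bar>f (grid N i) - f (c i)\<bar> \<le> \<eta> / (2 * B)"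
          using \<delta>(2)[of "grid N i" "c i"] c[of i] ab grid_nonneg[of N i] grid_le[of i N] i by auto
        moreover have "\<bar>g (c (Suc i)) - g (c i)\<bar> \<le> 2 * B"
          using B(2)[of "c i"] B(2)[of "c (Suc i)"] c[of i] c[of "Suc i"] ab by auto
        ultimately have "\<bar>f (grid N i) - f (c i)\<bar> * \<bar>g (c (Suc i)) - g (c i)\<bar> \<le> \<eta> / (2 * B) * (2 * B)"
          using B(1) \<eta> by (intro mult_mono) auto
        then show ?thesis using B(1) ik by (simp add: abs_mult)
      qed
    qed
    also have "\<dots> \<le> \<eta>" using \<eta> by simp
    finally show "\<bar>left_sum f g N b - left_sum f g N a -
      (\<Sum>i<N. f (clamped a b N i) * (g (clamped a b N (Suc i)) - g (clamped a b N i)))\<bar> \<le> \<eta>"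
      unfolding c_def .
  qed
qed

definition C\<theta> :: real where "C\<theta> = 2 / (1 - 2 powr (1 - \<theta>))"

lemma C\<theta>_pos: "C\<theta> > 0"
  using \<alpha> powr_less_one[of 2 "1 - \<theta>"] by (simp add: C\<theta>_def)

text \<open>N0 depends on \<eta> alone. With a, b and M quantified after it, one N serves all cells
  of a coarse grid at once.\<close>

lemma left_sum_local:
  assumes f: "continuous_on {0..T} f" and g: "continuous_on {0..T} g" and \<eta>: "\<eta> > 0"
  shows "\<exists>N0. \<forall>N\<ge>N0. \<forall>a b M. 0 \<le> a \<longrightarrow> a \<le> b \<longrightarrow> b \<le> T \<longrightarrow> 0 \<le> M \<longrightarrow>
    (\<forall>a' b' x y z w. a \<le> a' \<longrightarrow> b' \<le> b \<longrightarrow> {x, y, z, w} \<subseteq> {a'..b'} \<longrightarrow>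
      \<bar>f x - f y\<bar> * \<bar>g z - g w\<bar> \<le> M * (V b' - V a') powr \<theta>) \<longrightarrow>
    \<bar>left_sum f g N b - left_sum f g N a - f a * (g b - g a)\<bar> \<le> C\<theta> * M * (V b - V a) powr \<theta> + \<eta>"
proof -
  obtain N0 where N0: "\<And>N a b. N \<ge> N0 \<Longrightarrow> 0 \<le> a \<Longrightarrow> a \<le> b \<Longrightarrow> b \<le> T \<Longrightarrow>
    \<bar>left_sum f g N b - left_sum f g N a -
      (\<Sum>i<N. f (clamped a b N i) * (g (clamped a b N (Suc i)) - g (clamped a b N i)))\<bar> \<le> \<eta>"
    using left_sum_clamped[OF f g \<eta>] by blast
  show ?thesis
  \<comment> \<open>\<open>Suc N0\<close> excludes N = 0, for which every grid point is 0 and the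
    clamped grid would not end at b.\<close>
  proof (intro exI[of _ "Suc N0"] allI impI)
    fix N a b M
    assume N: "Suc N0 \<le> N" and ab: "0 \<le> a" "a \<le> b" "b \<le> T" and M: "0 \<le> M"
      and H: "\<forall>a' b' x y z w. a \<le> a' \<longrightarrow> b' \<le> b \<longrightarrow> {x, y, z, w} \<subseteq> {a'..b'} \<longrightarrow>
        \<bar>f x - f y\<bar> * \<bar>g z - g w\<bar> \<le> M * (V b' - V a') powr \<theta>"
    let ?c = "clamped a b N"
    have c0: "?c 0 = a" and cN: "?c N = b"
      using ab N grid_last[of N] by (auto simp: clamped_def grid_def)
    have "mono ?c" unfolding clamped_def by (intro monoI max.mono min.mono order_refl grid_mono)
    moreover have "mono_on {a..b} V" using ab by (intro mono_on_subset[OF V]) auto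
    ultimately have "\<bar>(\<Sum>i=0..<0+N. f (?c i) * (g (?c (Suc i)) - g (?c i))) - f (?c 0) * (g (?c (0 + N)) - g (?c 0))\<bar>
        \<le> C\<theta> * M * (V (?c (0 + N)) - V (?c 0)) powr \<theta>"
      unfolding C\<theta>_def using \<alpha> M H c0 cN by (intro young_sum[where a = a and b = b]) auto
    then have "\<bar>(\<Sum>i<N. f (?c i) * (g (?c (Suc i)) - g (?c i))) - f a * (g b - g a)\<bar>
        \<le> C\<theta> * M * (V b - V a) powr \<theta>"
      by (simp only: c0 cN add_0 lessThan_atLeast0)
    then show "\<bar>left_sum f g N b - left_sum f g N a - f a * (g b - g a)\<bar>
        \<le> C\<theta> * M * (V b - V a) powr \<theta> + \<eta>"
      using N0[of N a b] N ab by linarith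
  qed
qed

lemma left_sum_telescope:
  assumes "N > 0" "0 \<le> s" "s \<le> T"
  shows "(\<Sum>i<N. h (min s (grid N (Suc i))) - h (min s (grid N i))) = h s - (h 0 :: real)"
proof -
  have "(\<Sum>i<N. h (min s (grid N (Suc i))) - h (min s (grid N i))) = h (min s (grid N N)) - h (min s (grid N 0))"
    by (rule sum_lessThan_telescope)
  then show ?thesis using assms by (simp add: grid_last) (simp add: grid_def)
qed

text \<open>Two fine grids need not have a useful common refinement. Instead both left sums are
  compared with the sum over one coarse grid of n cells, from which each is at most e / 4
  away.\<close>

lemma left_sum_Cauchy:
  assumes f: "controlled f" and g: "controlled g" and s: "0 \<le> s" "s \<le> T"
  shows "Cauchy (\<lambda>N. left_sum f g N s)"
proof (rule CauchyI')
  fix e :: real assume e: "e > 0"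
  \<comment> \<open>W trades the exponent \<theta> for 1, after which the errors telescope. The
    \<open>+ 1\<close> in \<epsilon> keeps its denominator positive when V is constant.\<close>
  define W where "W = (V T - V 0) powr (\<theta> - 1)"
  define \<epsilon> where "\<epsilon> = e / 8 / (C\<theta> * (W * (V T - V 0) + 1))"
  have V0T: "V 0 \<le> V T" using VD T by simp
  have W0: "W * (V T - V 0) \<ge> 0" using V0T by (simp add: W_def)
  have den: "C\<theta> * (W * (V T - V 0) + 1) > 0" using C\<theta>_pos W0 by (intro mult_pos_pos) auto
  have \<epsilon>: "\<epsilon> > 0" unfolding \<epsilon>_def using den e by (intro divide_pos_pos) auto
  have "\<epsilon> * (C\<theta> * (W * (V T - V 0) + 1)) = e / 8"
    unfolding \<epsilon>_def
    by (rule nonzero_eq_divide_eq[THEN iffD1, OF _ refl]) (use den in linarith)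
  moreover have "\<epsilon> * (C\<theta> * (W * (V T - V 0) + 1)) = C\<theta> * \<epsilon> * (W * (V T - V 0)) + \<epsilon> * C\<theta>"
    by (simp add: algebra_simps)
  moreover have "\<epsilon> * C\<theta> > 0" using \<epsilon> C\<theta>_pos by (rule mult_pos_pos)
  ultimately have \<epsilon>e: "C\<theta> * \<epsilon> * (W * (V T - V 0)) \<le> e / 8"
    by linarith
  obtain \<delta> where \<delta>: "\<delta> > 0" "\<And>a b x y z w. 0 \<le> a \<Longrightarrow> b \<le> T \<Longrightarrow> b - a < \<delta> \<Longrightarrow>
    {x, y, z, w} \<subseteq> {a..b} \<Longrightarrow> \<bar>f x - f y\<bar> * \<bar>g z - g w\<bar> \<le> \<epsilon> * (V b - V a) powr \<theta>"
    using pair_small[OF f g \<epsilon>] by blast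
  obtain n where n: "T / \<delta> < real n" using reals_Archimedean2 by blast
  have "0 < T / \<delta>" using T \<delta>(1) by simp
  then have npos: "n > 0" using n by (cases n) auto
  have step: "T / n < \<delta>" using \<delta>(1) n npos by (simp add: field_simps)
  \<comment> \<open>n is fixed before \<eta>, and \<eta> before N0, so that the n cell errors of
    size \<eta> add up to e / 8.\<close>
  define \<eta> where "\<eta> = e / 8 / n"
  have \<eta>: "\<eta> > 0" using e npos by (simp add: \<eta>_def)
  let ?p = "\<lambda>i. min s (grid n i)"
  obtain N0 where N0: "\<And>N a b M. N \<ge> N0 \<Longrightarrow> 0 \<le> a \<Longrightarrow> a \<le> b \<Longrightarrow> b \<le> T \<Longrightarrow> 0 \<le> M \<Longrightarrow>
    (\<forall>a' b' x y z w. a \<le> a' \<longrightarrow> b' \<le> b \<longrightarrow> {x, y, z, w} \<subseteq> {a'..b'} \<longrightarrow>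
      \<bar>f x - f y\<bar> * \<bar>g z - g w\<bar> \<le> M * (V b' - V a') powr \<theta>) \<Longrightarrow>
    \<bar>left_sum f g N b - left_sum f g N a - f a * (g b - g a)\<bar> \<le> C\<theta> * M * (V b - V a) powr \<theta> + \<eta>"
    using left_sum_local[OF controlled_continuous[OF f] controlled_continuous[OF g] \<eta>] by metis
  have key: "\<bar>left_sum f g N s - (\<Sum>i<n. f (?p i) * (g (?p (Suc i)) - g (?p i)))\<bar> \<le> e / 4"
    if N: "N \<ge> N0" for N
  proof -
    have "left_sum f g N 0 = 0" using grid_nonneg by (simp add: left_sum_def min_absorb1)
    then have "left_sum f g N s = (\<Sum>i<n. left_sum f g N (?p (Suc i)) - left_sum f g N (?p i))"
      using left_sum_telescope[OF npos s, of "left_sum f g N"] by simp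
    then have "\<bar>left_sum f g N s - (\<Sum>i<n. f (?p i) * (g (?p (Suc i)) - g (?p i)))\<bar>
      = \<bar>\<Sum>i<n. left_sum f g N (?p (Suc i)) - left_sum f g N (?p i) - f (?p i) * (g (?p (Suc i)) - g (?p i))\<bar>"
      by (simp only: sum_subtractf)
    also have "\<dots> \<le> (\<Sum>i<n. \<bar>left_sum f g N (?p (Suc i)) - left_sum f g N (?p i) - f (?p i) * (g (?p (Suc i)) - g (?p i))\<bar>)"
      by (rule sum_abs)
    also have "\<dots> \<le> (\<Sum>i<n. C\<theta> * \<epsilon> * (W * (V (?p (Suc i)) - V (?p i))) + \<eta>)"
    proof (rule sum_mono)
      fix i assume "i \<in> {..<n}"
      then have i: "i < n" by simp
      have p: "0 \<le> ?p i" "?p i \<le> ?p (Suc i)" "?p (Suc i) \<le> T" "?p (Suc i) - ?p i < \<delta>"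
        using s grid_nonneg[of n] grid_mono[of i "Suc i" n] grid_le[of "Suc i" n] i grid_step[of n i] step
          \<delta>(1) by (auto simp: min_def)
      have "\<bar>left_sum f g N (?p (Suc i)) - left_sum f g N (?p i) - f (?p i) * (g (?p (Suc i)) - g (?p i))\<bar>
        \<le> C\<theta> * \<epsilon> * (V (?p (Suc i)) - V (?p i)) powr \<theta> + \<eta>"
        using p \<epsilon> by (intro N0[OF N] allI impI \<delta>(2)) auto
      also have "(V (?p (Suc i)) - V (?p i)) powr \<theta> \<le> W * (V (?p (Suc i)) - V (?p i)) powr 1"
        unfolding W_def using p \<alpha> by (intro powr_omega_le) auto
      also have "(V (?p (Suc i)) - V (?p i)) powr 1 = V (?p (Suc i)) - V (?p i)"
        using VD[OF p(1-3)] by simp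
      finally show "\<bar>left_sum f g N (?p (Suc i)) - left_sum f g N (?p i) - f (?p i) * (g (?p (Suc i)) - g (?p i))\<bar>
        \<le> C\<theta> * \<epsilon> * (W * (V (?p (Suc i)) - V (?p i))) + \<eta>"
        using \<epsilon> C\<theta>_pos by simp
    qed
    also have "\<dots> = C\<theta> * \<epsilon> * (W * (V s - V 0)) + real n * \<eta>"
      unfolding sum.distrib sum_distrib_left[symmetric] left_sum_telescope[OF npos s, of V] by simp
    also have "\<dots> \<le> C\<theta> * \<epsilon> * (W * (V T - V 0)) + real n * \<eta>"
      using C\<theta>_pos \<epsilon> VD[of s T] s
      by (intro add_right_mono mult_left_mono) (auto simp: W_def)
    also have "\<dots> \<le> e / 4" using \<epsilon>e npos by (simp add: \<eta>_def)
    finally show ?thesis .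
  qed
  show "\<exists>M. \<forall>m\<ge>M. \<forall>n>m. dist (left_sum f g m s) (left_sum f g n s) < e"
  proof (intro exI[of _ N0] allI impI)
    fix m k assume "m \<ge> N0" "k > m"
    then have "m \<ge> N0" "k \<ge> N0" by auto
    from this[THEN key] show "dist (left_sum f g m s) (left_sum f g k s) < e"
      using e unfolding dist_real_def by linarith
  qed
qed

text \<open>M stays free, so that the same F can receive the small constant of
  \<open>pair_small\<close> on short intervals and the constant of \<open>pair_global\<close> on all
  intervals.\<close>

lemma young_integral_estimate:
  assumes f: "controlled f" and g: "controlled g"
  obtains F where "F 0 = 0" "\<And>a b M. 0 \<le> a \<Longrightarrow> a \<le> b \<Longrightarrow> b \<le> T \<Longrightarrow> 0 \<le> M \<Longrightarrow>
    (\<And>a' b' x y z w. a \<le> a' \<Longrightarrow> b' \<le> b \<Longrightarrow> {x, y, z, w} \<subseteq> {a'..b'} \<Longrightarrow>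
      \<bar>f x - f y\<bar> * \<bar>g z - g w\<bar> \<le> M * (V b' - V a') powr \<theta>) \<Longrightarrow>
    \<bar>F b - F a - f a * (g b - g a)\<bar> \<le> C\<theta> * M * (V b - V a) powr \<theta>"
proof -
  define F where "F = (\<lambda>s. lim (\<lambda>N. left_sum f g N s))"
  have lim: "(\<lambda>N. left_sum f g N s) \<longlonglongrightarrow> F s" if "0 \<le> s" "s \<le> T" for s
    using left_sum_Cauchy[OF f g that] unfolding F_def
    by (simp add: Cauchy_convergent_iff convergent_LIMSEQ_iff)
  show thesis
  proof (rule that[of F])
    have "left_sum f g N 0 = 0" for N using grid_nonneg by (simp add: left_sum_def min_absorb1)
    then show "F 0 = 0" by (simp add: F_def)
  next
    fix a b M
    assume ab: "0 \<le> a" "a \<le> b" "b \<le> T" and M: "0 \<le> M"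
      and H: "\<And>a' b' x y z w. a \<le> a' \<Longrightarrow> b' \<le> b \<Longrightarrow> {x, y, z, w} \<subseteq> {a'..b'} \<Longrightarrow>
        \<bar>f x - f y\<bar> * \<bar>g z - g w\<bar> \<le> M * (V b' - V a') powr \<theta>"
    have l: "(\<lambda>N. \<bar>left_sum f g N b - left_sum f g N a - f a * (g b - g a)\<bar>) \<longlonglongrightarrow>
        \<bar>F b - F a - f a * (g b - g a)\<bar>"
      using ab by (intro tendsto_intros lim) auto
    show "\<bar>F b - F a - f a * (g b - g a)\<bar> \<le> C\<theta> * M * (V b - V a) powr \<theta>"
    \<comment> \<open>For fixed \<eta> the bound holds for all large N and passes to the limit; then
      \<eta> tends to 0.\<close>
    proof (rule field_le_epsilon)
      fix \<eta> :: real assume "\<eta> > 0"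
      from left_sum_local[OF controlled_continuous[OF f] controlled_continuous[OF g] this]
      obtain N0 where "\<forall>N\<ge>N0. \<bar>left_sum f g N b - left_sum f g N a - f a * (g b - g a)\<bar>
          \<le> C\<theta> * M * (V b - V a) powr \<theta> + \<eta>"
        using ab M H by metis
      then show "\<bar>F b - F a - f a * (g b - g a)\<bar> \<le> C\<theta> * M * (V b - V a) powr \<theta> + \<eta>"
        by (intro LIMSEQ_le_const2[OF l]) blast
    qed
  qed
qed

end

section \<open>Riemann-Stieltjes integrals over tagged divisions\<close>

lemma has_RS_integral_unique:
  assumes "a \<le> b" "has_RS_integral f g a b I" "has_RS_integral f g a b J"
  shows "I = J"
proof (rule ccontr)
  assume "I \<noteq> J"
  define e where "e = \<bar>I - J\<bar> / 2"
  have "e > 0" using \<open>I \<noteq> J\<close> by (simp add: e_def)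
  obtain \<delta>1 where \<delta>1: "\<delta>1 > 0" "\<And>D. D tagged_division_of {a..b} \<Longrightarrow> \<forall>(x, K)\<in>D. Sup K - Inf K < \<delta>1 \<Longrightarrow>
      \<bar>(\<Sum>(x, K)\<in>D. f x * (g (Sup K) - g (Inf K))) - I\<bar> < e"
    using assms(2)[unfolded has_RS_integral_def, THEN spec, THEN mp, OF \<open>e > 0\<close>] by blast
  obtain \<delta>2 where \<delta>2: "\<delta>2 > 0" "\<And>D. D tagged_division_of {a..b} \<Longrightarrow> \<forall>(x, K)\<in>D. Sup K - Inf K < \<delta>2 \<Longrightarrow>
      \<bar>(\<Sum>(x, K)\<in>D. f x * (g (Sup K) - g (Inf K))) - J\<bar> < e"
    using assms(3)[unfolded has_RS_integral_def, THEN spec, THEN mp, OF \<open>e > 0\<close>] by blast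
  define \<delta> where "\<delta> = min \<delta>1 \<delta>2"
  \<comment> \<open>Cousin's lemma provides a division meeting both mesh conditions. The radius
    \<delta> / 2 keeps each cell shorter than \<delta>.\<close>
  have "gauge (\<lambda>x. ball x (\<delta> / 2))" using \<delta>1(1) \<delta>2(1) by (auto simp: \<delta>_def gauge_def)
  then obtain D where D: "D tagged_division_of {a..b}" "(\<lambda>x. ball x (\<delta> / 2)) fine D"
    using fine_division_exists_real by blast
  have small: "Sup K - Inf K < \<delta>" if xK: "(x, K) \<in> D" for x K
  proof -
    obtain c d where K: "K = {c..d}" using tagged_division_ofD(4)[OF D(1) xK] by auto
    have "x \<in> K" using tagged_division_ofD(2)[OF D(1) xK] .
    then have cd: "c \<le> d" using K by auto
    have "K \<subseteq> ball x (\<delta> / 2)" using D(2) xK by (auto simp: fine_def)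
    then have "c \<in> ball x (\<delta> / 2)" "d \<in> ball x (\<delta> / 2)" using K cd by auto
    then have "d - c < \<delta>" unfolding mem_ball dist_real_def by linarith
    then show ?thesis using K cd by simp
  qed
  have "\<bar>(\<Sum>(x, K)\<in>D. f x * (g (Sup K) - g (Inf K))) - I\<bar> < e"
    by (rule \<delta>1(2)[OF D(1)]) (use small in \<open>fastforce simp: \<delta>_def\<close>)
  moreover have "\<bar>(\<Sum>(x, K)\<in>D. f x * (g (Sup K) - g (Inf K))) - J\<bar> < e"
    by (rule \<delta>2(2)[OF D(1)]) (use small in \<open>fastforce simp: \<delta>_def\<close>)
  ultimately have "\<bar>I - J\<bar> < e + e" by linarith
  then show False by (simp add: e_def)
qed

lemma has_RS_integral_cong:
  assumes "\<And>x. x \<in> {a..b} \<Longrightarrow> f x = f' x" "\<And>x. x \<in> {a..b} \<Longrightarrow> g x = g' x"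
  shows "has_RS_integral f g a b I \<longleftrightarrow> has_RS_integral f' g' a b I"
proof -
  have *: "(\<Sum>(x, K)\<in>D. f x * (g (Sup K) - g (Inf K))) = (\<Sum>(x, K)\<in>D. f' x * (g' (Sup K) - g' (Inf K)))"
    if D: "D tagged_division_of {a..b}" for D
  proof (rule sum.cong[OF refl], clarify)
    fix x K assume xK: "(x, K) \<in> D"
    obtain c d where K: "K = {c..d}" using tagged_division_ofD(4)[OF D xK] by auto
    have "x \<in> K" "K \<subseteq> {a..b}" using tagged_division_ofD(2,3)[OF D xK] .
    then show "f x * (g (Sup K) - g (Inf K)) = f' x * (g' (Sup K) - g' (Inf K))"
      using K assms by auto
  qed
  then have "(D tagged_division_of {a..b} \<and> (\<forall>(x, K)\<in>D. Sup K - Inf K < \<delta>) \<longrightarrow>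
      \<bar>(\<Sum>(x, K)\<in>D. f x * (g (Sup K) - g (Inf K))) - I\<bar> < \<epsilon>) \<longleftrightarrow>
      (D tagged_division_of {a..b} \<and> (\<forall>(x, K)\<in>D. Sup K - Inf K < \<delta>) \<longrightarrow>
      \<bar>(\<Sum>(x, K)\<in>D. f' x * (g' (Sup K) - g' (Inf K))) - I\<bar> < \<epsilon>)" for \<delta> \<epsilon> D
    by auto
  then show ?thesis unfolding has_RS_integral_def by simp
qed

lemma RS_integral_cong:
  assumes "\<And>x. x \<in> {a..b} \<Longrightarrow> f x = f' x" "\<And>x. x \<in> {a..b} \<Longrightarrow> g x = g' x"
  shows "RS_integral f g a b = RS_integral f' g' a b"
  unfolding RS_integral_def proof -
  have "has_RS_integral f g a b = has_RS_integral f' g' a b"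
    by (intro ext has_RS_integral_cong assms)
  then show "The (has_RS_integral f g a b) = The (has_RS_integral f' g' a b)" by simp
qed

section \<open>Calculus of primitives\<close>

context young
begin

lemma primitiveD:
  assumes "primitive f g F" "\<epsilon> > 0"
  obtains \<delta> where "\<delta> > 0" "\<And>a x b. 0 \<le> a \<Longrightarrow> a \<le> x \<Longrightarrow> x \<le> b \<Longrightarrow> b \<le> T \<Longrightarrow> b - a < \<delta> \<Longrightarrow>
    \<bar>F b - F a - f x * (g b - g a)\<bar> \<le> \<epsilon> * (V b - V a)"
  using assms unfolding primitive_def by metis

lemma primitiveI:
  assumes "F 0 = 0" "\<And>\<epsilon>. \<epsilon> > 0 \<Longrightarrow> \<exists>\<delta>>0. \<forall>a x b. 0 \<le> a \<longrightarrow> a \<le> x \<longrightarrow> x \<le> b \<longrightarrow> b \<le> T \<longrightarrow> b - a < \<delta> \<longrightarrow>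
    \<bar>F b - F a - f x * (g b - g a)\<bar> \<le> \<epsilon> * (V b - V a)"
  shows "primitive f g F"
  using assms unfolding primitive_def by blast

lemma primitive_0: "primitive f g F \<Longrightarrow> F 0 = 0"
  by (simp add: primitive_def)

text \<open>On every cell the error is at most the increment of \<epsilon> * V, and these increments
  telescope over the division, whatever its tags.\<close>

lemma primitive_has_RS_integral:
  assumes F: "primitive f g F" and s: "0 \<le> s" "s \<le> T"
  shows "has_RS_integral f g 0 s (F s)"
  unfolding has_RS_integral_def
proof (intro allI impI)
  fix e :: real assume e: "e > 0"
  have V0T: "V T - V 0 \<ge> 0" using VD T by simp
  define \<epsilon> where "\<epsilon> = e / (V T - V 0 + 1)"
  have \<epsilon>: "\<epsilon> > 0" using e V0T by (simp add: \<epsilon>_def)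
  have \<epsilon>e: "\<epsilon> * (V T - V 0) < e" using e V0T by (simp add: \<epsilon>_def field_simps)
  obtain \<delta> where \<delta>: "\<delta> > 0" "\<And>a x b. 0 \<le> a \<Longrightarrow> a \<le> x \<Longrightarrow> x \<le> b \<Longrightarrow> b \<le> T \<Longrightarrow> b - a < \<delta> \<Longrightarrow>
      \<bar>F b - F a - f x * (g b - g a)\<bar> \<le> \<epsilon> * (V b - V a)"
    using primitiveD[OF F \<epsilon>] by blast
  show "\<exists>\<delta>>0. \<forall>D. D tagged_division_of {0..s} \<and> (\<forall>(x, K)\<in>D. Sup K - Inf K < \<delta>) \<longrightarrow>
      \<bar>(\<Sum>(x, K)\<in>D. f x * (g (Sup K) - g (Inf K))) - F s\<bar> < e"
  proof (intro exI conjI allI impI, rule \<delta>(1), elim conjE)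
    fix D assume D: "D tagged_division_of {0..s}" and mesh: "\<forall>(x, K)\<in>D. Sup K - Inf K < \<delta>"
    have tele: "(\<Sum>(x, K)\<in>D. h (Sup K) - h (Inf K)) = h s - h 0" for h :: "real \<Rightarrow> real"
      using additive_tagged_division_1[OF s(1) D] .
    have "(\<Sum>(x, K)\<in>D. f x * (g (Sup K) - g (Inf K))) - F s =
        (\<Sum>(x, K)\<in>D. f x * (g (Sup K) - g (Inf K)) - (F (Sup K) - F (Inf K)))"
      using tele[of F] primitive_0[OF F] by (simp add: case_prod_unfold sum_subtractf)
    then have "\<bar>(\<Sum>(x, K)\<in>D. f x * (g (Sup K) - g (Inf K))) - F s\<bar> \<le>
        (\<Sum>(x, K)\<in>D. \<bar>f x * (g (Sup K) - g (Inf K)) - (F (Sup K) - F (Inf K))\<bar>)"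
      by (simp add: case_prod_unfold)
    also have "\<dots> \<le> (\<Sum>(x, K)\<in>D. \<epsilon> * V (Sup K) - \<epsilon> * V (Inf K))"
    proof (rule sum_mono, clarify)
      fix x K assume xK: "(x, K) \<in> D"
      obtain a b where K: "K = {a..b}" using tagged_division_ofD(4)[OF D xK] by auto
      have xs: "x \<in> K" "K \<subseteq> {0..s}" using tagged_division_ofD(2,3)[OF D xK] .
      then have ab: "0 \<le> a" "a \<le> x" "x \<le> b" "b \<le> T" using K s by auto
      then have sup: "Sup K = b" "Inf K = a" using K by auto
      have "b - a < \<delta>" using mesh xK sup by auto
      from \<delta>(2)[OF ab this]
      show "\<bar>f x * (g (Sup K) - g (Inf K)) - (F (Sup K) - F (Inf K))\<bar> \<le> \<epsilon> * V (Sup K) - \<epsilon> * V (Inf K)"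
        unfolding sup by (simp add: right_diff_distrib abs_minus_commute)
    qed
    also have "\<dots> = \<epsilon> * V s - \<epsilon> * V 0" by (rule tele)
    also have "\<dots> \<le> \<epsilon> * (V T - V 0)" using VD[of s T] s \<epsilon> by (simp add: right_diff_distrib)
    also note \<epsilon>e
    finally show "\<bar>(\<Sum>(x, K)\<in>D. f x * (g (Sup K) - g (Inf K))) - F s\<bar> < e" .
  qed
qed

lemma RS_integral_primitive:
  assumes "primitive f g F" "0 \<le> s" "s \<le> T"
  shows "RS_integral f g 0 s = F s"
  unfolding RS_integral_def
  using primitive_has_RS_integral[OF assms] has_RS_integral_unique[OF assms(2)] by blast

lemma primitive_unique:
  assumes "primitive f g F" "primitive f g G" "0 \<le> s" "s \<le> T"
  shows "F s = G s"
  using RS_integral_primitive[OF assms(1,3,4)] RS_integral_primitive[OF assms(2,3,4)] by simp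

lemma primitive_cong:
  assumes "primitive f g F" "\<And>s. s \<in> {0..T} \<Longrightarrow> f s = f' s" "\<And>s. s \<in> {0..T} \<Longrightarrow> g s = g' s"
    "\<And>s. s \<in> {0..T} \<Longrightarrow> F s = F' s"
  shows "primitive f' g' F'"
proof -
  have "F' 0 = F 0" using assms(4)[of 0] T by simp
  moreover have "F' b - F' a - f' x * (g' b - g' a) = F b - F a - f x * (g b - g a)"
    if "0 \<le> a" "a \<le> x" "x \<le> b" "b \<le> T" for a x b
    using that assms(2)[of x] assms(3)[of a] assms(3)[of b] assms(4)[of a] assms(4)[of b] by simp
  ultimately show ?thesis using assms(1) unfolding primitive_def by (simp cong: imp_cong)
qed

lemma primitive_one: "primitive (\<lambda>_. 1) g (\<lambda>s. g s - g 0)"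
proof (rule primitiveI)
  fix \<epsilon> :: real assume "\<epsilon> > 0"
  then show "\<exists>\<delta>>0. \<forall>a x b. 0 \<le> a \<longrightarrow> a \<le> x \<longrightarrow> x \<le> b \<longrightarrow> b \<le> T \<longrightarrow> b - a < \<delta> \<longrightarrow>
    \<bar>(g b - g 0) - (g a - g 0) - 1 * (g b - g a)\<bar> \<le> \<epsilon> * (V b - V a)"
    using VD by (intro exI[of _ 1]) auto
qed simp

lemma primitive_zero: "primitive (\<lambda>_. 0) g (\<lambda>_. 0)" "primitive f (\<lambda>_. 0) (\<lambda>_. 0)"
proof -
  have "\<exists>\<delta>>0. \<forall>a x b. 0 \<le> a \<longrightarrow> a \<le> x \<longrightarrow> x \<le> b \<longrightarrow> b \<le> T \<longrightarrow> b - a < \<delta> \<longrightarrow> 0 \<le> \<epsilon> * (V b - V a)"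
    if "\<epsilon> > 0" for \<epsilon> :: real
    using VD that by (intro exI[of _ 1]) auto
  then show "primitive (\<lambda>_. 0) g (\<lambda>_. 0)" "primitive f (\<lambda>_. 0) (\<lambda>_. 0)"
    by (simp_all add: primitive_def)
qed

text \<open>
  Linearity, associativity and integration by parts are all instances of this.
\<close>

lemma primitive_combine:
  assumes F: "primitive f g F" and G: "primitive f' g' G" and H0: "H 0 = 0" and K: "K \<ge> 0"
    and H: "\<And>a x b. 0 \<le> a \<Longrightarrow> a \<le> x \<Longrightarrow> x \<le> b \<Longrightarrow> b \<le> T \<Longrightarrow>
      \<exists>y\<in>{a..b}. \<exists>z\<in>{a..b}. \<bar>H b - H a - h x * (k b - k a)\<bar> \<le>
        K * (\<bar>F b - F a - f y * (g b - g a)\<bar> + \<bar>G b - G a - f' z * (g' b - g' a)\<bar>)"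
  shows "primitive h k H"
proof (rule primitiveI, rule H0)
  fix \<epsilon> :: real assume \<epsilon>: "\<epsilon> > 0"
  \<comment> \<open>Two errors are multiplied by K; K + 1 in place of K admits K = 0.\<close>
  define e where "e = \<epsilon> / (2 * (K + 1))"
  have e: "e > 0" using \<epsilon> K by (simp add: e_def)
  have "2 * (K + 1) * e = \<epsilon>" using K by (simp add: e_def)
  then have eK: "K * (2 * e) \<le> \<epsilon>" using e by (simp add: algebra_simps)
  obtain \<delta>1 where \<delta>1: "\<delta>1 > 0" "\<And>a x b. 0 \<le> a \<Longrightarrow> a \<le> x \<Longrightarrow> x \<le> b \<Longrightarrow> b \<le> T \<Longrightarrow> b - a < \<delta>1 \<Longrightarrow>
      \<bar>F b - F a - f x * (g b - g a)\<bar> \<le> e * (V b - V a)"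
    using primitiveD[OF F e] by blast
  obtain \<delta>2 where \<delta>2: "\<delta>2 > 0" "\<And>a x b. 0 \<le> a \<Longrightarrow> a \<le> x \<Longrightarrow> x \<le> b \<Longrightarrow> b \<le> T \<Longrightarrow> b - a < \<delta>2 \<Longrightarrow>
      \<bar>G b - G a - f' x * (g' b - g' a)\<bar> \<le> e * (V b - V a)"
    using primitiveD[OF G e] by blast
  show "\<exists>\<delta>>0. \<forall>a x b. 0 \<le> a \<longrightarrow> a \<le> x \<longrightarrow> x \<le> b \<longrightarrow> b \<le> T \<longrightarrow> b - a < \<delta> \<longrightarrow>
    \<bar>H b - H a - h x * (k b - k a)\<bar> \<le> \<epsilon> * (V b - V a)"
  proof (intro exI[of _ "min \<delta>1 \<delta>2"] conjI allI impI)
    fix a x b assume *: "0 \<le> a" "a \<le> x" "x \<le> b" "b \<le> T" "b - a < min \<delta>1 \<delta>2"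
    from H[OF *(1-4)] obtain y z where yz: "y \<in> {a..b}" "z \<in> {a..b}" and
      le: "\<bar>H b - H a - h x * (k b - k a)\<bar> \<le>
        K * (\<bar>F b - F a - f y * (g b - g a)\<bar> + \<bar>G b - G a - f' z * (g' b - g' a)\<bar>)"
      by blast
    note le
    also have "\<dots> \<le> K * (e * (V b - V a) + e * (V b - V a))"
      using * yz K by (intro mult_left_mono add_mono \<delta>1(2) \<delta>2(2)) auto
    also have "\<dots> = K * (2 * e) * (V b - V a)" by (simp add: algebra_simps)
    also have "\<dots> \<le> \<epsilon> * (V b - V a)" using eK VD[of a b] * by (intro mult_right_mono) auto
    finally show "\<bar>H b - H a - h x * (k b - k a)\<bar> \<le> \<epsilon> * (V b - V a)" .
  qed (use \<delta>1(1) \<delta>2(1) in auto)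
qed

lemma primitive_add_left:
  assumes "primitive f g F" "primitive f' g F'"
  shows "primitive (\<lambda>s. f s + f' s) g (\<lambda>s. F s + F' s)"
proof (rule primitive_combine[OF assms, where K = 1])
  fix a x b :: real assume "a \<le> x" "x \<le> b"
  then show "\<exists>y\<in>{a..b}. \<exists>z\<in>{a..b}. \<bar>(F b + F' b) - (F a + F' a) - (f x + f' x) * (g b - g a)\<bar> \<le>
    1 * (\<bar>F b - F a - f y * (g b - g a)\<bar> + \<bar>F' b - F' a - f' z * (g b - g a)\<bar>)"
    unfolding distrib_right mult_1 by (intro bexI[of _ x]) auto
qed (use assms[THEN primitive_0] in auto)

lemma primitive_add_right:
  assumes "primitive f g F" "primitive f g' F'"
  shows "primitive f (\<lambda>s. g s + g' s) (\<lambda>s. F s + F' s)"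
proof (rule primitive_combine[OF assms, where K = 1])
  fix a x b :: real assume *: "a \<le> x" "x \<le> b"
  have "f x * ((g b + g' b) - (g a + g' a)) = f x * (g b - g a) + f x * (g' b - g' a)"
    by (simp add: algebra_simps)
  then show "\<exists>y\<in>{a..b}. \<exists>z\<in>{a..b}. \<bar>(F b + F' b) - (F a + F' a) - f x * ((g b + g' b) - (g a + g' a))\<bar> \<le>
    1 * (\<bar>F b - F a - f y * (g b - g a)\<bar> + \<bar>F' b - F' a - f z * (g' b - g' a)\<bar>)"
    using * unfolding mult_1 by (intro bexI[of _ x]) auto
qed (use assms[THEN primitive_0] in auto)

lemma primitive_scale:
  assumes "primitive f g F"
  shows "primitive (\<lambda>s. c * f s) g (\<lambda>s. c * F s)" "primitive f (\<lambda>s. c * g s) (\<lambda>s. c * F s)"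
proof -
  have *: "\<bar>c * F b - c * F a - (c * f x) * (g b - g a)\<bar> = \<bar>c\<bar> * \<bar>F b - F a - f x * (g b - g a)\<bar>"
    "\<bar>c * F b - c * F a - f x * (c * g b - c * g a)\<bar> = \<bar>c\<bar> * \<bar>F b - F a - f x * (g b - g a)\<bar>" for a x b
    unfolding abs_mult[symmetric] by (simp_all add: algebra_simps)
  show "primitive (\<lambda>s. c * f s) g (\<lambda>s. c * F s)"
    by (rule primitive_combine[OF assms assms, where K = "\<bar>c\<bar>"])
      (unfold *, use primitive_0[OF assms] in \<open>auto intro!: bexI mult_left_mono\<close>)
  show "primitive f (\<lambda>s. c * g s) (\<lambda>s. c * F s)"
    by (rule primitive_combine[OF assms assms, where K = "\<bar>c\<bar>"])
      (unfold *, use primitive_0[OF assms] in \<open>auto intro!: bexI mult_left_mono\<close>)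
qed

lemma primitive_sum_left:
  assumes "finite A" "\<And>w. w \<in> A \<Longrightarrow> primitive (f w) g (F w)"
  shows "primitive (\<lambda>s. \<Sum>w\<in>A. c w * f w s) g (\<lambda>s. \<Sum>w\<in>A. c w * F w s)"
  using assms by (induction A rule: finite_induct) (auto intro!: primitive_zero primitive_add_left primitive_scale)

lemma primitive_sum_right:
  assumes "finite A" "\<And>w. w \<in> A \<Longrightarrow> primitive f (g w) (F w)"
  shows "primitive f (\<lambda>s. \<Sum>w\<in>A. c w * g w s) (\<lambda>s. \<Sum>w\<in>A. c w * F w s)"
  using assms by (induction A rule: finite_induct) (auto intro!: primitive_zero primitive_add_right primitive_scale)

text \<open>In differentials: dG = h dF and dF = f dg give dG = h f dg. The error for G is kept and
  the error for F is multiplied by the bounded h; K = B + 1 dominates both factors.\<close>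

lemma primitive_assoc:
  assumes F: "primitive f g F" and G: "primitive h F G" and h: "continuous_on {0..T} h"
  shows "primitive (\<lambda>s. h s * f s) g G"
proof -
  obtain B where B: "B > 0" "\<And>x. x \<in> {0..T} \<Longrightarrow> \<bar>h x\<bar> \<le> B" using continuous_bound[OF h] by blast
  show ?thesis
  proof (rule primitive_combine[OF F G, where K = "B + 1"])
    fix a x b :: real assume *: "0 \<le> a" "a \<le> x" "x \<le> b" "b \<le> T"
    let ?F = "F b - F a - f x * (g b - g a)" and ?G = "G b - G a - h x * (F b - F a)"
    have "G b - G a - (h x * f x) * (g b - g a) = ?G + h x * ?F" by (simp add: algebra_simps)
    then have "\<bar>G b - G a - (h x * f x) * (g b - g a)\<bar> \<le> \<bar>?G\<bar> + \<bar>h x\<bar> * \<bar>?F\<bar>"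
      using abs_triangle_ineq[of ?G "h x * ?F"] by (simp add: abs_mult)
    also have "\<dots> \<le> (B + 1) * \<bar>?G\<bar> + (B + 1) * \<bar>?F\<bar>"
      using B(1) B(2)[of x] * mult_right_mono[of 1 "B + 1" "\<bar>?G\<bar>"] by (intro add_mono mult_right_mono) auto
    also have "\<dots> = (B + 1) * (\<bar>?F\<bar> + \<bar>?G\<bar>)" by (simp add: algebra_simps)
    finally show "\<exists>y\<in>{a..b}. \<exists>z\<in>{a..b}. \<bar>G b - G a - (h x * f x) * (g b - g a)\<bar> \<le>
      (B + 1) * (\<bar>F b - F a - f y * (g b - g a)\<bar> + \<bar>G b - G a - h z * (F b - F a)\<bar>)"
      using * by (intro bexI[of _ x]) auto
  qed (use B primitive_0[OF G] in auto)
qed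

text \<open>The increment of f g over an interval is exactly f b * (g b - g a) + g a * (f b - f a).
  Tagging one integral at the right end and the other at the left leaves no second-order term, so
  the difference of the two sides is a primitive of 0.\<close>

lemma integration_by_parts:
  assumes F: "primitive f g F" and G: "primitive g f G" and s: "0 \<le> s" "s \<le> T"
  shows "f s * g s - f 0 * g 0 = F s + G s"
proof -
  have "primitive (\<lambda>_. 0) (\<lambda>_. 0) (\<lambda>s. f s * g s - f 0 * g 0 - (F s + G s))" (is "primitive _ _ ?H")
  proof (rule primitive_combine[OF F G, where K = 1])
    fix a x b :: real assume *: "a \<le> x" "x \<le> b"
    have tri: "\<bar>w\<bar> \<le> 1 * (\<bar>u\<bar> + \<bar>v\<bar>)" if "w = - u - v" for u v w :: real
      using that abs_triangle_ineq4[of "- u" v] by simp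
    have "?H b - ?H a - 0 * (0 - 0) = - (F b - F a - f b * (g b - g a)) - (G b - G a - g a * (f b - f a))"
      by (simp add: algebra_simps)
    then have "\<bar>?H b - ?H a - 0 * (0 - 0)\<bar> \<le>
        1 * (\<bar>F b - F a - f b * (g b - g a)\<bar> + \<bar>G b - G a - g a * (f b - f a)\<bar>)"
      by (rule tri)
    then show "\<exists>y\<in>{a..b}. \<exists>z\<in>{a..b}. \<bar>?H b - ?H a - 0 * (0 - 0)\<bar> \<le>
        1 * (\<bar>F b - F a - f y * (g b - g a)\<bar> + \<bar>G b - G a - g z * (f b - f a)\<bar>)"
      using * by (intro bexI[of _ b] bexI[of _ a]) auto
  qed (use primitive_0[OF F] primitive_0[OF G] in auto)
  from primitive_unique[OF this primitive_zero(1) s] show ?thesis by simp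
qed

text \<open>That F is controlled by the same V and the same \<alpha> is what allows it to be
  integrated again.\<close>

lemma primitive_exists:
  assumes f: "controlled f" and g: "controlled g"
  obtains F where "primitive f g F" "controlled F"
proof -
  obtain F where F0: "F 0 = 0" and F: "\<And>a b M. 0 \<le> a \<Longrightarrow> a \<le> b \<Longrightarrow> b \<le> T \<Longrightarrow> 0 \<le> M \<Longrightarrow>
    (\<And>a' b' x y z w. a \<le> a' \<Longrightarrow> b' \<le> b \<Longrightarrow> {x, y, z, w} \<subseteq> {a'..b'} \<Longrightarrow>
      \<bar>f x - f y\<bar> * \<bar>g z - g w\<bar> \<le> M * (V b' - V a') powr \<theta>) \<Longrightarrow>
    \<bar>F b - F a - f a * (g b - g a)\<bar> \<le> C\<theta> * M * (V b - V a) powr \<theta>"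
    using young_integral_estimate[OF f g] by metis
  obtain B where B: "B > 0" "\<And>x. x \<in> {0..T} \<Longrightarrow> \<bar>f x\<bar> \<le> B"
    using continuous_bound[OF controlled_continuous[OF f]] by blast
  obtain L where L: "L > 0" "\<And>a b x y. 0 \<le> a \<Longrightarrow> b \<le> T \<Longrightarrow> x \<in> {a..b} \<Longrightarrow> y \<in> {a..b} \<Longrightarrow>
      \<bar>g x - g y\<bar> \<le> L * (V b - V a) powr \<alpha>" using controlled_bound[OF g] by blast
  have V0T: "V 0 \<le> V T" using VD T by simp
  have prim: "primitive f g F"
  proof (rule primitiveI, rule F0)
    fix \<epsilon> :: real assume \<epsilon>: "\<epsilon> > 0"
    \<comment> \<open>In C\<theta> + 1 the constant C\<theta> is for the estimate at the left tag
      and 1 for moving the tag from a to x. The power lowers \<theta> to 1, and the last 1 keeps W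
      positive when V is constant.\<close>
    define W where "W = (C\<theta> + 1) * ((V T - V 0) powr (\<theta> - 1) + 1)"
    have W: "W > 0" unfolding W_def using C\<theta>_pos by (intro mult_pos_pos add_nonneg_pos) auto
    define e where "e = \<epsilon> / W"
    have e: "e > 0" using \<epsilon> W by (simp add: e_def)
    have eW: "e * W = \<epsilon>" using W by (simp add: e_def)
    obtain \<delta> where \<delta>: "\<delta> > 0" "\<And>a b x y z w. 0 \<le> a \<Longrightarrow> b \<le> T \<Longrightarrow> b - a < \<delta> \<Longrightarrow>
      {x, y, z, w} \<subseteq> {a..b} \<Longrightarrow> \<bar>f x - f y\<bar> * \<bar>g z - g w\<bar> \<le> e * (V b - V a) powr \<theta>"
      using pair_small[OF f g e] by blast
    show "\<exists>\<delta>>0. \<forall>a x b. 0 \<le> a \<longrightarrow> a \<le> x \<longrightarrow> x \<le> b \<longrightarrow> b \<le> T \<longrightarrow> b - a < \<delta> \<longrightarrow>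
      \<bar>F b - F a - f x * (g b - g a)\<bar> \<le> \<epsilon> * (V b - V a)"
    proof (intro exI conjI allI impI, rule \<delta>(1))
      fix a x b assume *: "0 \<le> a" "a \<le> x" "x \<le> b" "b \<le> T" "b - a < \<delta>"
      have 1: "\<bar>F b - F a - f a * (g b - g a)\<bar> \<le> C\<theta> * e * (V b - V a) powr \<theta>"
        using * e by (intro F \<delta>(2)) auto
      have 2: "\<bar>f x - f a\<bar> * \<bar>g b - g a\<bar> \<le> e * (V b - V a) powr \<theta>"
        using * by (intro \<delta>(2)) auto
      have "F b - F a - f x * (g b - g a) =
          (F b - F a - f a * (g b - g a)) - (f x - f a) * (g b - g a)"
        by (simp add: algebra_simps)
      then have "\<bar>F b - F a - f x * (g b - g a)\<bar> \<le>
          \<bar>F b - F a - f a * (g b - g a)\<bar> + \<bar>f x - f a\<bar> * \<bar>g b - g a\<bar>"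
        unfolding abs_mult[symmetric] by linarith
      also have "\<dots> \<le> (C\<theta> + 1) * e * (V b - V a) powr \<theta>"
        using 1 2 by (simp add: algebra_simps)
      also have "\<dots> \<le> (C\<theta> + 1) * e * ((V T - V 0) powr (\<theta> - 1) * (V b - V a) powr 1)"
        using * e C\<theta>_pos \<alpha> by (intro mult_left_mono powr_omega_le mult_nonneg_nonneg) auto
      also have "(V b - V a) powr 1 = V b - V a" using VD[of a b] * by simp
      also have "(C\<theta> + 1) * e * ((V T - V 0) powr (\<theta> - 1) * (V b - V a)) =
          e * ((C\<theta> + 1) * (V T - V 0) powr (\<theta> - 1)) * (V b - V a)"
        by (simp only: mult_ac)
      also have "\<dots> \<le> e * W * (V b - V a)"
        using e C\<theta>_pos VD[of a b] * unfolding W_def by (intro mult_right_mono mult_left_mono) auto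
      finally show "\<bar>F b - F a - f x * (g b - g a)\<bar> \<le> \<epsilon> * (V b - V a)" unfolding eW .
    qed
  qed
  \<comment> \<open>The power bound would not exclude jumps of F where V jumps. Continuity is taken
    from g and from the small factor \<epsilon> in \<open>primitive\<close> instead.\<close>
  have "continuous_on {0..T} F"
  proof (rule continuous_onI)
    fix x e :: real assume x: "x \<in> {0..T}" and e: "e > 0"
    define \<epsilon> where "\<epsilon> = e / (4 * (V T - V 0 + 1))"
    have \<epsilon>: "\<epsilon> > 0" using e V0T by (simp add: \<epsilon>_def)
    have "\<epsilon> * (4 * (V T - V 0 + 1)) = e" using V0T by (simp add: \<epsilon>_def)
    then have \<epsilon>e: "\<epsilon> * (V T - V 0) \<le> e / 4" using \<epsilon> by (simp add: algebra_simps)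
    obtain \<delta> where \<delta>: "\<delta> > 0" "\<And>a x b. 0 \<le> a \<Longrightarrow> a \<le> x \<Longrightarrow> x \<le> b \<Longrightarrow> b \<le> T \<Longrightarrow> b - a < \<delta> \<Longrightarrow>
      \<bar>F b - F a - f x * (g b - g a)\<bar> \<le> \<epsilon> * (V b - V a)"
      using primitiveD[OF prim \<epsilon>] by blast
    obtain \<delta>' where \<delta>': "\<delta>' > 0"
      "\<And>x y. x \<in> {0..T} \<Longrightarrow> y \<in> {0..T} \<Longrightarrow> \<bar>x - y\<bar> < \<delta>' \<Longrightarrow> \<bar>g x - g y\<bar> < e / (4 * B)"
      using continuous_osc[OF controlled_continuous[OF g], of "e / (4 * B)"] e B(1) by auto
    have *: "\<bar>F b - F a\<bar> \<le> e / 2"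
      if ab: "0 \<le> a" "a \<le> b" "b \<le> T" "b - a < min \<delta> \<delta>'" for a b
    proof -
      have "\<bar>g b - g a\<bar> \<le> e / (4 * B)" using ab by (intro less_imp_le \<delta>'(2)) auto
      then have "\<bar>f a\<bar> * \<bar>g b - g a\<bar> \<le> B * (e / (4 * B))" using B ab by (intro mult_mono) auto
      also have "\<dots> = e / 4" using B(1) by simp
      finally have 1: "\<bar>f a * (g b - g a)\<bar> \<le> e / 4" by (simp add: abs_mult)
      have "\<bar>F b - F a - f a * (g b - g a)\<bar> \<le> \<epsilon> * (V b - V a)" using ab by (intro \<delta>(2)) auto
      also have "\<dots> \<le> \<epsilon> * (V T - V 0)" using VD[of 0 a] VD[of b T] ab \<epsilon> by (intro mult_left_mono) auto
      finally show ?thesis using 1 \<epsilon>e by linarith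
    qed
    show "\<exists>d>0. \<forall>x'\<in>{0..T}. dist x' x < d \<longrightarrow> dist (F x') (F x) \<le> e"
    proof (intro exI[of _ "min \<delta> \<delta>'"] conjI ballI impI)
      fix y assume y: "y \<in> {0..T}" "dist y x < min \<delta> \<delta>'"
      then show "dist (F y) (F x) \<le> e"
        using *[of x y] *[of y x] x e by (cases "x \<le> y") (auto simp: dist_real_def abs_minus_commute)
    qed (use \<delta>(1) \<delta>'(1) in auto)
  qed
  moreover have "\<exists>K\<ge>0. \<forall>a b. 0 \<le> a \<longrightarrow> a \<le> b \<longrightarrow> b \<le> T \<longrightarrow> \<bar>F b - F a\<bar> \<le> K * (V b - V a) powr \<alpha>"
  proof -
    obtain M where M: "M \<ge> 0" "\<And>a b x y z w. 0 \<le> a \<Longrightarrow> b \<le> T \<Longrightarrow>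
      {x, y, z, w} \<subseteq> {a..b} \<Longrightarrow> \<bar>f x - f y\<bar> * \<bar>g z - g w\<bar> \<le> M * (V b - V a) powr \<theta>"
      using pair_global[OF f g] by blast
    \<comment> \<open>The first summand bounds the deviation from f a * (g b - g a), the second
      bounds that product itself.\<close>
    define K where "K = C\<theta> * M * (V T - V 0) powr (\<theta> - \<alpha>) + B * L"
    show ?thesis
    proof (intro exI[of _ K] conjI allI impI)
      show "K \<ge> 0" using C\<theta>_pos M(1) B(1) L(1) by (simp add: K_def)
    next
      fix a b assume ab: "0 \<le> a" "a \<le> b" "b \<le> T"
      have "\<bar>F b - F a - f a * (g b - g a)\<bar> \<le> C\<theta> * M * (V b - V a) powr \<theta>"
        using ab M(1) by (intro F M(2)) auto
      also have "\<dots> \<le> C\<theta> * M * ((V T - V 0) powr (\<theta> - \<alpha>) * (V b - V a) powr \<alpha>)"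
        using ab C\<theta>_pos M(1) \<alpha> by (intro mult_left_mono powr_omega_le) auto
      finally have 1: "\<bar>F b - F a - f a * (g b - g a)\<bar> \<le>
        C\<theta> * M * ((V T - V 0) powr (\<theta> - \<alpha>) * (V b - V a) powr \<alpha>)" .
      have "\<bar>f a\<bar> * \<bar>g b - g a\<bar> \<le> B * (L * (V b - V a) powr \<alpha>)"
        using B L(2)[of a b b a] ab by (intro mult_mono) auto
      then have 2: "\<bar>f a * (g b - g a)\<bar> \<le> B * L * (V b - V a) powr \<alpha>" by (simp add: abs_mult mult_ac)
      have "K * (V b - V a) powr \<alpha> =
        C\<theta> * M * ((V T - V 0) powr (\<theta> - \<alpha>) * (V b - V a) powr \<alpha>) + B * L * (V b - V a) powr \<alpha>"
        unfolding K_def by (simp only: distrib_right mult.assoc)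
      then show "\<bar>F b - F a\<bar> \<le> K * (V b - V a) powr \<alpha>" using 1 2 by linarith
    qed
  qed
  ultimately have "controlled F" unfolding controlled_def by blast
  with prim show thesis by (rule that)
qed

lemma controlled_const: "controlled (\<lambda>_. c)"
  unfolding controlled_def by (auto intro!: exI[of _ 0])

lemma controlled_add:
  assumes f: "controlled f" and g: "controlled g"
  shows "controlled (\<lambda>s. f s + g s)"
proof -
  obtain K where K: "K > 0" "\<And>a b x y. 0 \<le> a \<Longrightarrow> b \<le> T \<Longrightarrow> x \<in> {a..b} \<Longrightarrow> y \<in> {a..b} \<Longrightarrow>
      \<bar>f x - f y\<bar> \<le> K * (V b - V a) powr \<alpha>" using controlled_bound[OF f] by blast
  obtain L where L: "L > 0" "\<And>a b x y. 0 \<le> a \<Longrightarrow> b \<le> T \<Longrightarrow> x \<in> {a..b} \<Longrightarrow> y \<in> {a..b} \<Longrightarrow>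
      \<bar>g x - g y\<bar> \<le> L * (V b - V a) powr \<alpha>" using controlled_bound[OF g] by blast
  have "\<bar>(f b + g b) - (f a + g a)\<bar> \<le> (K + L) * (V b - V a) powr \<alpha>"
    if "0 \<le> a" "a \<le> b" "b \<le> T" for a b
    using K(2)[of a b b a] L(2)[of a b b a] that unfolding distrib_right by auto
  moreover have "K + L \<ge> 0" using K(1) L(1) by simp
  ultimately show ?thesis
    using controlled_continuous[OF f] controlled_continuous[OF g]
    unfolding controlled_def by (blast intro: continuous_on_add)
qed

lemma controlled_scale:
  assumes f: "controlled f"
  shows "controlled (\<lambda>s. c * f s)"
proof -
  obtain K where K: "K > 0" "\<And>a b x y. 0 \<le> a \<Longrightarrow> b \<le> T \<Longrightarrow> x \<in> {a..b} \<Longrightarrow> y \<in> {a..b} \<Longrightarrow>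
      \<bar>f x - f y\<bar> \<le> K * (V b - V a) powr \<alpha>" using controlled_bound[OF f] by blast
  have "\<bar>c * f b - c * f a\<bar> \<le> \<bar>c\<bar> * K * (V b - V a) powr \<alpha>"
    if "0 \<le> a" "a \<le> b" "b \<le> T" for a b
    using mult_left_mono[OF K(2)[of a b b a], of "\<bar>c\<bar>"] that
    by (simp add: abs_mult[symmetric] right_diff_distrib mult.assoc)
  moreover have "\<bar>c\<bar> * K \<ge> 0" using K(1) by simp
  ultimately show ?thesis
    using controlled_continuous[OF f]
    unfolding controlled_def by (blast intro: continuous_on_mult_left)
qed

lemma controlled_sum:
  "finite A \<Longrightarrow> (\<And>w. w \<in> A \<Longrightarrow> controlled (f w)) \<Longrightarrow> controlled (\<lambda>s. \<Sum>w\<in>A. c w * f w s)"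
  by (induction A rule: finite_induct) (auto intro!: controlled_const controlled_add controlled_scale)

end

section \<open>The free vector space on words\<close>

lemma lookup_scaleR [simp]:
  fixes x :: "'k \<Rightarrow>\<^sub>0 real"
  shows "Poly_Mapping.lookup (r *\<^sub>R x) k = r * Poly_Mapping.lookup x k"
proof -
  have "finite {i. r * Poly_Mapping.lookup x i \<noteq> 0}"
    by (rule finite_subset[OF _ finite_lookup[of x]]) auto
  then show ?thesis unfolding scaleR_poly_mapping_def by (simp add: Abs_poly_mapping_inverse)
qed

text \<open>The common form of \<open>pairing\<close>, \<open>linear_ext\<close> and the
  homomorphism \<open>poly_to_tensor\<close>, with values in any real vector space.\<close>

definition free_ext :: "('k \<Rightarrow> 'v::real_vector) \<Rightarrow> ('k \<Rightarrow>\<^sub>0 real) \<Rightarrow> 'v"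
  where "free_ext f x = (\<Sum>k\<in>Poly_Mapping.keys x. Poly_Mapping.lookup x k *\<^sub>R f k)"

lemma free_ext_superset:
  assumes "finite A" "Poly_Mapping.keys x \<subseteq> A"
  shows "free_ext f x = (\<Sum>k\<in>A. Poly_Mapping.lookup x k *\<^sub>R f k)"
  unfolding free_ext_def using assms by (intro sum.mono_neutral_left) (auto simp: in_keys_iff)

lemma linear_free_ext: "linear (free_ext f)"
proof (rule linearI)
  fix x y :: "'a \<Rightarrow>\<^sub>0 real" and r :: real
  let ?A = "Poly_Mapping.keys x \<union> Poly_Mapping.keys y"
  have "free_ext f (x + y) = (\<Sum>k\<in>?A. Poly_Mapping.lookup (x + y) k *\<^sub>R f k)"
    by (rule free_ext_superset) (auto dest: set_mp[OF Poly_Mapping.keys_add])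
  moreover have "free_ext f x = (\<Sum>k\<in>?A. Poly_Mapping.lookup x k *\<^sub>R f k)"
    "free_ext f y = (\<Sum>k\<in>?A. Poly_Mapping.lookup y k *\<^sub>R f k)"
    by (rule free_ext_superset; simp)+
  ultimately show "free_ext f (x + y) = free_ext f x + free_ext f y"
    by (simp add: lookup_add scaleR_left_distrib sum.distrib)
  have "free_ext f (r *\<^sub>R x) = (\<Sum>k\<in>Poly_Mapping.keys x. Poly_Mapping.lookup (r *\<^sub>R x) k *\<^sub>R f k)"
    by (rule free_ext_superset) (auto simp: in_keys_iff)
  then show "free_ext f (r *\<^sub>R x) = r *\<^sub>R free_ext f x"
    by (simp add: free_ext_def scaleR_sum_right)
qed

lemma free_ext_single [simp]: "free_ext f (Poly_Mapping.single k 1) = f k"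
  by (simp add: free_ext_def)

lemma linear_eq_on_basis:
  fixes f g :: "('k \<Rightarrow>\<^sub>0 real) \<Rightarrow> 'v::real_vector"
  assumes f: "linear f" and g: "linear g"
    and "\<And>k. f (Poly_Mapping.single k 1) = g (Poly_Mapping.single k 1)"
  shows "f x = g x"
proof -
  have x: "x = (\<Sum>k\<in>Poly_Mapping.keys x. Poly_Mapping.lookup x k *\<^sub>R Poly_Mapping.single k 1)"
  proof (rule poly_mapping_eqI)
    fix i
    show "Poly_Mapping.lookup x i =
      Poly_Mapping.lookup (\<Sum>k\<in>Poly_Mapping.keys x. Poly_Mapping.lookup x k *\<^sub>R Poly_Mapping.single k 1) i"
      by (cases "i \<in> Poly_Mapping.keys x")
        (auto simp: lookup_sum lookup_single when_def in_keys_iff if_distrib[of "(*) _"] cong: if_cong)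
  qed
  have "h x = (\<Sum>k\<in>Poly_Mapping.keys x. Poly_Mapping.lookup x k *\<^sub>R h (Poly_Mapping.single k 1))"
    if h: "linear h" for h :: "('k \<Rightarrow>\<^sub>0 real) \<Rightarrow> 'v"
    by (subst x) (simp add: linear_sum[OF h] linear_scale[OF h])
  from this[OF f] this[OF g] show ?thesis using assms(3) by simp
qed

lemma bilinear_eq_on_basis:
  fixes f g :: "('k \<Rightarrow>\<^sub>0 real) \<Rightarrow> ('l \<Rightarrow>\<^sub>0 real) \<Rightarrow> 'v::real_vector"
  assumes f: "bilinear f" and g: "bilinear g"
    and "\<And>k l. f (Poly_Mapping.single k 1) (Poly_Mapping.single l 1) =
      g (Poly_Mapping.single k 1) (Poly_Mapping.single l 1)"
  shows "f x y = g x y"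
proof -
  have lin: "linear (f u)" "linear (g u)" "linear (\<lambda>x. f x y)" "linear (\<lambda>x. g x y)" for u
    using f g by (simp_all add: bilinear_def)
  have "f (Poly_Mapping.single k 1) y = g (Poly_Mapping.single k 1) y" for k
    by (rule linear_eq_on_basis[OF lin(1,2)]) (rule assms(3))
  then show ?thesis
    by (rule linear_eq_on_basis[OF lin(3,4)])
qed

lemma bilinear_compose_linear:
  assumes "bilinear f" "linear h"
  shows "bilinear (\<lambda>x y. h (f x y))"
  using assms linear_compose[of "f x" h for x] linear_compose[of "\<lambda>x. f x y" h for y]
  by (simp add: bilinear_def o_def)

lemma bilinear_compose:
  assumes "bilinear f" "linear h" "linear k"
  shows "bilinear (\<lambda>x y. f (h x) (k y))"
  using assms linear_compose[of k "f (h x)" for x] linear_compose[of h "\<lambda>x. f x (k y)" for y]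
  by (simp add: bilinear_def o_def)

lemma bilinear_flip: "bilinear f \<Longrightarrow> bilinear (\<lambda>x y. f y x)"
  unfolding bilinear_def by auto

lemma bilinear_plus: "bilinear f \<Longrightarrow> bilinear g \<Longrightarrow> bilinear (\<lambda>x y. f x y + g x y)"
  unfolding bilinear_def by (auto intro: linear_compose_add)

lemma pairing_eq_free_ext: "pairing \<sigma> = free_ext \<sigma>"
  by (rule ext) (simp add: pairing_def free_ext_def)

lemma linear_pairing: "linear (pairing \<sigma>)"
  unfolding pairing_eq_free_ext by (rule linear_free_ext)

lemma pairing_word [simp]: "pairing \<sigma> (word w) = \<sigma> w"
  by (simp add: pairing_eq_free_ext word_def)

lemma linear_ext_eq_free_ext: "linear_ext f = free_ext f"
  by (rule ext) (simp add: linear_ext_def free_ext_def)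

lemma linear_linear_ext: "linear (linear_ext f)"
  unfolding linear_ext_eq_free_ext by (rule linear_free_ext)

lemma linear_ext_word [simp]: "linear_ext f (word w) = f w"
  by (simp add: linear_ext_eq_free_ext word_def)

lemma bilinear_bilinear_ext: "bilinear (bilinear_ext f)"
proof -
  have 1: "bilinear_ext f x y = free_ext (\<lambda>w. free_ext (f w) y) x" for x y
    by (simp add: bilinear_ext_def free_ext_def scaleR_sum_right)
  have 2: "bilinear_ext f x y = free_ext (\<lambda>v. free_ext (\<lambda>w. f w v) x) y" for x y
    unfolding bilinear_ext_def free_ext_def scaleR_sum_right scaleR_scaleR
    by (subst sum.swap) (simp add: mult.commute)
  have "linear (bilinear_ext f x)" for x
    using linear_free_ext[of "\<lambda>v. free_ext (\<lambda>w. f w v) x"] unfolding 2[abs_def] .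
  moreover have "linear (\<lambda>x. bilinear_ext f x y)" for y
    using linear_free_ext[of "\<lambda>w. free_ext (f w) y"] unfolding 1 by (simp add: eta_contract_eq)
  ultimately show ?thesis unfolding bilinear_def by blast
qed

lemma bilinear_ext_word [simp]: "bilinear_ext f (word w) (word v) = f w v"
  by (simp add: bilinear_ext_def word_def)

lemma bilinear_shuffle: "bilinear shuffle"
  unfolding shuffle_def by (rule bilinear_bilinear_ext)

lemma linear_append_letter: "linear (\<lambda>x. append_letter x i)"
  unfolding append_letter_def by (rule linear_linear_ext)

lemma append_letter_word [simp]: "append_letter (word w) i = word (w @ [i])"
  by (simp add: append_letter_def)

lemma mem_tensor_ge1: "x \<in> tensor_ge1 \<longleftrightarrow> Poly_Mapping.lookup x [] = 0"
proof
  assume "x \<in> tensor_ge1"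
  then show "Poly_Mapping.lookup x [] = 0"
    unfolding tensor_ge1_def
    by (induction rule: span_induct) (auto simp: subspace_def lookup_add word_def lookup_single when_def)
next
  assume x: "Poly_Mapping.lookup x [] = 0"
  have "linear_ext word x = x"
    using linear_eq_on_basis[OF linear_linear_ext linear_id, of word x] by (simp add: word_def[symmetric])
  moreover have "linear_ext word x \<in> tensor_ge1"
    unfolding linear_ext_def tensor_ge1_def using x
    by (intro span_sum span_scale span_base imageI) (auto simp: in_keys_iff)
  ultimately show "x \<in> tensor_ge1" by simp
qed

section \<open>The shuffle algebra\<close>

lemma shuffle_word: "shuffle (word w) (word v) = (if w = [] then word v else if v = [] then word w
    else halfshuffle_word w v + halfshuffle_word v w)"
  by (simp add: shuffle_def)

lemma shuffle_commute: "shuffle x y = shuffle y x"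
  by (rule bilinear_eq_on_basis[OF bilinear_shuffle bilinear_flip[OF bilinear_shuffle]])
    (auto simp: word_def[symmetric] shuffle_word add.commute)

lemma shuffle_empty [simp]: "shuffle (word []) x = x" "shuffle x (word []) = x"
proof -
  have "linear (shuffle (word []))" using bilinear_shuffle unfolding bilinear_def by blast
  then show "shuffle (word []) x = x"
    by (rule linear_eq_on_basis[OF _ linear_id, unfolded id_def]) (simp add: word_def[symmetric] shuffle_word)
  then show "shuffle x (word []) = x" by (simp add: shuffle_commute)
qed

text \<open>The usual recursion by last letters: a halfshuffle of nonempty words is the part of the
  shuffle in which the last letter comes from the second factor. The fact \<open>half\<close> puts
  the two base cases and the recursion of the halfshuffle into one formula.\<close>

lemma shuffle_append_letter:
  "shuffle (append_letter x i) (append_letter y j) =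
    append_letter (shuffle (append_letter x i) y) j + append_letter (shuffle x (append_letter y j)) i"
proof -
  note A = linear_append_letter
  have b1: "bilinear (\<lambda>x y. shuffle (append_letter x i) (append_letter y j))"
    by (rule bilinear_compose[OF bilinear_shuffle A A])
  have b2: "bilinear (\<lambda>x y. append_letter (shuffle (append_letter x i) y) j +
      append_letter (shuffle x (append_letter y j)) i)"
    using bilinear_plus[OF
      bilinear_compose_linear[OF bilinear_compose[OF bilinear_shuffle A[of i] linear_id] A[of j]]
      bilinear_compose_linear[OF bilinear_compose[OF bilinear_shuffle linear_id A[of j]] A[of i]]]
    by (simp only: id_def)
  have half: "halfshuffle_word (w @ [i]) (v @ [j]) = append_letter (shuffle (word (w @ [i])) (word v)) j"
    for w v :: "'a list" and i j
    by (cases "v = []") (simp_all add: halfshuffle_word_letter[of _ j] halfshuffle_word_snoc shuffle_word)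
  show ?thesis
  proof (rule bilinear_eq_on_basis[OF b1 b2])
    fix w v :: "'a list"
    show "shuffle (append_letter (Poly_Mapping.single w 1) i) (append_letter (Poly_Mapping.single v 1) j) =
      append_letter (shuffle (append_letter (Poly_Mapping.single w 1) i) (Poly_Mapping.single v 1)) j +
      append_letter (shuffle (Poly_Mapping.single w 1) (append_letter (Poly_Mapping.single v 1) j)) i"
      unfolding word_def[symmetric] append_letter_word
      by (simp add: shuffle_word[of "w @ [i]" "v @ [j]"] half) (simp add: shuffle_commute)
  qed
qed

lemma shuffle_add:
  "shuffle (x + y) z = shuffle x z + shuffle y z" "shuffle x (y + z) = shuffle x y + shuffle x z"
  by (rule bilinear_ladd[OF bilinear_shuffle] bilinear_radd[OF bilinear_shuffle])+

lemma append_letter_add: "append_letter (x + y) i = append_letter x i + append_letter y i"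
  by (rule linear_add[OF linear_append_letter])

text \<open>The last letter of a triple shuffle comes from one of the three factors. The right-hand
  side treats them alike up to bracketing, which gives associativity by induction.\<close>

lemma shuffle_shuffle_append_letter:
  fixes x y z :: "'d tensor" and i j k :: 'd
  defines "X \<equiv> append_letter x i" and "Y \<equiv> append_letter y j" and "Z \<equiv> append_letter z k"
  shows "shuffle (shuffle X Y) Z = append_letter (shuffle (shuffle X Y) z) k +
    append_letter (shuffle (shuffle X y) Z) j + append_letter (shuffle (shuffle x Y) Z) i"
  unfolding X_def Y_def Z_def
  by (simp add: shuffle_append_letter shuffle_add append_letter_add add_ac)

lemma shuffle_assoc_word:
  "shuffle (shuffle (word a) (word b)) (word c) = shuffle (word a) (shuffle (word b) (word c))"
proof (induction "length a + length b + length c" arbitrary: a b c rule: less_induct)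
  case less
  show ?case
  proof (cases "a = [] \<or> b = [] \<or> c = []")
    case True
    then show ?thesis by auto
  next
    case False
    then obtain a' i b' j c' k where abc: "a = a' @ [i]" "b = b' @ [j]" "c = c' @ [k]"
      by (metis rev_exhaust)
    let ?A = "word a" and ?B = "word b" and ?C = "word c"
    have "shuffle (shuffle ?A ?B) ?C = append_letter (shuffle (shuffle ?A ?B) (word c')) k +
        append_letter (shuffle (shuffle ?A (word b')) ?C) j + append_letter (shuffle (shuffle (word a') ?B) ?C) i"
      using shuffle_shuffle_append_letter[of "word a'" i "word b'" j "word c'" k] by (simp add: abc)
    also have "\<dots> = append_letter (shuffle ?A (shuffle ?B (word c'))) k +
        append_letter (shuffle ?A (shuffle (word b') ?C)) j + append_letter (shuffle (word a') (shuffle ?B ?C)) i"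
      using less[of a b c'] less[of a b' c] less[of a' b c] by (simp add: abc)
    \<comment> \<open>By commutativity the bracketing on the right becomes one on the left with
      cyclically permuted factors, so the same expansion applies backwards.\<close>
    also have "\<dots> = append_letter (shuffle (shuffle ?B ?C) (word a')) i +
        append_letter (shuffle (shuffle ?B (word c')) ?A) k + append_letter (shuffle (shuffle (word b') ?C) ?A) j"
      by (simp add: shuffle_commute add_ac)
    also have "\<dots> = shuffle (shuffle ?B ?C) ?A"
      using shuffle_shuffle_append_letter[of "word b'" j "word c'" k "word a'" i] by (simp add: abc)
    finally show ?thesis by (simp add: shuffle_commute)
  qed
qed

lemma shuffle_assoc: "shuffle (shuffle x y) z = shuffle x (shuffle y z)"
proof -
  have lin: "linear (shuffle u)" "linear (\<lambda>x. shuffle x u)" for u :: "'a tensor"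
    using bilinear_shuffle unfolding bilinear_def by blast+
  have words: "shuffle (shuffle (word a) (word b)) z = shuffle (word a) (shuffle (word b) z)" for a b
    by (rule linear_eq_on_basis[OF lin(1) linear_compose[OF lin(1) lin(1), unfolded o_def]])
      (simp only: word_def[symmetric] shuffle_assoc_word)
  have b1: "bilinear (\<lambda>x y. shuffle (shuffle x y) z)"
    by (rule bilinear_compose_linear[OF bilinear_shuffle lin(2)])
  have b2: "bilinear (\<lambda>x y. shuffle x (shuffle y z))"
    using bilinear_compose[OF bilinear_shuffle linear_id lin(2)[of z]] by (simp only: id_def)
  show ?thesis
    by (rule bilinear_eq_on_basis[OF b1 b2]) (simp only: word_def[symmetric] words)
qed

section \<open>The homomorphism from polynomials to the shuffle algebra\<close>

interpretation shuffle_prod: comm_monoid_set shuffle "word []"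
  by unfold_locales (simp_all add: shuffle_assoc shuffle_commute[of _ "word []"], rule shuffle_commute)

definition shuffle_power :: "'d tensor \<Rightarrow> nat \<Rightarrow> 'd tensor"
  where "shuffle_power x n = (shuffle x ^^ n) (word [])"

lemma shuffle_power_add: "shuffle_power x (m + n) = shuffle (shuffle_power x m) (shuffle_power x n)"
  by (induction m) (simp_all add: shuffle_power_def shuffle_assoc)

definition shuffle_monom :: "(('d::finite) \<Rightarrow>\<^sub>0 nat) \<Rightarrow> 'd tensor"
  where "shuffle_monom m = shuffle_prod.F (\<lambda>j. shuffle_power (word [j]) (Poly_Mapping.lookup m j)) UNIV"

lemma shuffle_monom_add: "shuffle_monom (m + n) = shuffle (shuffle_monom m) (shuffle_monom n)"
  by (simp add: shuffle_monom_def lookup_add shuffle_power_add shuffle_prod.distrib)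

lemma shuffle_monom_0: "shuffle_monom 0 = word []"
  by (simp add: shuffle_monom_def shuffle_power_def)

lemma shuffle_monom_single: "shuffle_monom (Poly_Mapping.single j 1) = word [j]"
proof -
  have "shuffle_monom (Poly_Mapping.single j 1) = shuffle_prod.F (\<lambda>i. if i = j then word [i] else word []) UNIV"
    unfolding shuffle_monom_def
    by (rule shuffle_prod.cong) (auto simp: shuffle_power_def lookup_single)
  then show ?thesis by (simp add: shuffle_prod.delta)
qed

lemma bilinear_poly_mult: "bilinear ((*) :: 'd poly_ring \<Rightarrow> 'd poly_ring \<Rightarrow> 'd poly_ring)"
proof -
  \<comment> \<open>Scaling is multiplication by a constant polynomial, so bilinearity reduces to
    the ring laws.\<close>
  have scale: "r *\<^sub>R p = Poly_Mapping.single 0 r * p" for r and p :: "'d poly_ring"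
    unfolding mult_map_scale_conv_mult[symmetric]
    by (rule poly_mapping_eqI) (simp add: Poly_Mapping.map.rep_eq when_def)
  show ?thesis
    unfolding bilinear_def by (auto intro!: linearI simp: scale algebra_simps)
qed

lemma shuffle_hom_free_ext_monom: "shuffle_hom (free_ext shuffle_monom :: ('d::finite) poly_ring \<Rightarrow> _)"
  unfolding shuffle_hom_def
proof (intro conjI allI)
  show lin: "linear (free_ext shuffle_monom :: 'd poly_ring \<Rightarrow> _)" by (rule linear_free_ext)
  have "(1 :: 'd poly_ring) = Poly_Mapping.single 0 1" by simp
  then show "free_ext shuffle_monom (1 :: 'd poly_ring) = word []"
    by (metis free_ext_single shuffle_monom_0)
  fix p q :: "'d poly_ring"
  show "free_ext shuffle_monom (p * q) = shuffle (free_ext shuffle_monom p) (free_ext shuffle_monom q)"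
    by (rule bilinear_eq_on_basis[OF bilinear_compose_linear[OF bilinear_poly_mult lin]
          bilinear_compose[OF bilinear_shuffle lin lin]])
      (simp only: mult_single free_ext_single shuffle_monom_add mult_1)
qed

lemma shuffle_hom_unique:
  assumes h: "shuffle_hom h" and h': "shuffle_hom h'"
    and var: "\<And>j. h (poly_var j) = h' (poly_var j)"
  shows "h = h'"
proof
  fix p
  have hom: "h (p * q) = shuffle (h p) (h q)" "h' (p * q) = shuffle (h' p) (h' q)" "h 1 = h' 1" for p q
    using h h' by (auto simp: shuffle_hom_def)
  have "h (Poly_Mapping.single m 1) = h' (Poly_Mapping.single m 1)" for m
  \<comment> \<open>A monomial is built one variable at a time; since j does not yet occur in m,
    updating at j is adding a power of that variable.\<close>
  proof (induction m rule: update_induct)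
    case const
    then show ?case using hom(3) by simp
  next
    case (update m j n)
    have "h (Poly_Mapping.single (Poly_Mapping.single j n) 1) = h' (Poly_Mapping.single (Poly_Mapping.single j n) 1)"
    proof (induction n)
      case 0
      then show ?case using hom(3) by simp
    next
      case (Suc n)
      have "Poly_Mapping.single (Poly_Mapping.single j (Suc n)) (1 :: real) =
          poly_var j * Poly_Mapping.single (Poly_Mapping.single j n) 1"
        by (simp add: poly_var_def mult_single single_add[symmetric])
      then show ?case using Suc var[of j] by (simp add: hom)
    qed
    moreover have "Poly_Mapping.update j n m = m + Poly_Mapping.single j n"
      using update(1) by (intro poly_mapping_eqI)
        (auto simp: lookup_update lookup_add lookup_single when_def in_keys_iff)
    then have "Poly_Mapping.single (Poly_Mapping.update j n m) (1 :: real) =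
        Poly_Mapping.single m 1 * Poly_Mapping.single (Poly_Mapping.single j n) 1"
      by (simp add: mult_single)
    ultimately show ?case using update by (simp add: hom)
  qed
  moreover have "linear h" "linear h'" using h h' by (simp_all add: shuffle_hom_def)
  ultimately show "h p = h' p" using linear_eq_on_basis by blast
qed

text \<open>Existence and uniqueness together give the definite description its meaning.\<close>

lemma poly_to_tensor_eq: "poly_to_tensor = (free_ext shuffle_monom :: ('d::finite) poly_ring \<Rightarrow> _)"
  unfolding poly_to_tensor_def
proof (rule the_equality)
  show *: "shuffle_hom (free_ext shuffle_monom :: 'd poly_ring \<Rightarrow> _) \<and>
      (\<forall>j :: 'd. free_ext shuffle_monom (poly_var j) = word [j])"
    using shuffle_hom_free_ext_monom by (simp add: poly_var_def shuffle_monom_single[simplified])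
  fix h assume "shuffle_hom h \<and> (\<forall>j :: 'd. h (poly_var j) = word [j])"
  with * show "h = free_ext shuffle_monom" by (intro shuffle_hom_unique) auto
qed

text \<open>A character of the shuffle algebra composed with the homomorphism is a character of the
  polynomial ring, hence evaluation at the point of its values on the letters.\<close>

lemma pairing_poly_to_tensor:
  fixes p :: "('d::finite) poly_ring"
  assumes \<sigma>: "\<sigma> [] = 1" "\<And>x y. pairing \<sigma> (shuffle x y) = pairing \<sigma> x * pairing \<sigma> y"
  shows "pairing \<sigma> (poly_to_tensor p) = poly_eval p (\<chi> j. \<sigma> [j])"
proof -
  have pow: "pairing \<sigma> (shuffle_power x n) = pairing \<sigma> x ^ n" for x n
    by (induction n) (simp_all add: shuffle_power_def \<sigma>)
  have "pairing \<sigma> (shuffle_prod.F f A) = (\<Prod>j\<in>A. pairing \<sigma> (f j))" if "finite A" for f and A :: "'d set"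
    using that by (induction A rule: finite_induct) (simp_all add: \<sigma>)
  then have mon: "pairing \<sigma> (shuffle_monom m) = (\<Prod>j\<in>UNIV. \<sigma> [j] ^ Poly_Mapping.lookup m j)" for m :: "'d \<Rightarrow>\<^sub>0 nat"
    by (simp add: shuffle_monom_def pow)
  show ?thesis
    unfolding poly_to_tensor_eq free_ext_def poly_eval_def
    by (simp add: linear_sum[OF linear_pairing] linear_scale[OF linear_pairing] mon)
qed

lemma lookup_append_letter_empty: "Poly_Mapping.lookup (append_letter x i) [] = 0"
proof -
  have "append_letter x i \<in> tensor_ge1"
    unfolding append_letter_def linear_ext_def tensor_ge1_def
    by (intro span_sum span_scale span_base) auto
  then show ?thesis by (simp add: mem_tensor_ge1)
qed

lemma lookup_halfshuffle_word_empty: "Poly_Mapping.lookup (halfshuffle_word w v) [] = 0"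
  by (subst halfshuffle_word.simps) (auto simp: lookup_append_letter_empty word_def lookup_single)

text \<open>The coefficient of the empty word is itself a shuffle character. It is 0 on all letters,
  so on images of polynomials it is evaluation at the origin.\<close>

lemma poly_to_tensor_ge1:
  fixes p :: "('d::finite) poly_ring"
  assumes "poly_eval p 0 = 0"
  shows "poly_to_tensor p \<in> tensor_ge1"
proof -
  let ?\<sigma> = "\<lambda>w :: 'd list. if w = [] then 1 else 0 :: real"
  have \<sigma>: "pairing ?\<sigma> x = Poly_Mapping.lookup x []" for x
    unfolding pairing_def by (auto simp: in_keys_iff if_distrib[of "(*) _"] cong: if_cong)
  have mult: "pairing ?\<sigma> (shuffle x y) = pairing ?\<sigma> x * pairing ?\<sigma> y" for x y
  proof (rule bilinear_eq_on_basis[OF bilinear_compose_linear[OF bilinear_shuffle linear_pairing]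
        bilinear_compose[OF bilinear_times linear_pairing linear_pairing]])
    fix w v :: "'d list"
    show "pairing ?\<sigma> (shuffle (Poly_Mapping.single w 1) (Poly_Mapping.single v 1)) =
        pairing ?\<sigma> (Poly_Mapping.single w 1) * pairing ?\<sigma> (Poly_Mapping.single v 1)"
      unfolding word_def[symmetric] shuffle_word \<sigma>
      by (simp add: lookup_add lookup_halfshuffle_word_empty) (simp add: word_def lookup_single)
  qed
  have "(\<chi> j. ?\<sigma> [j]) = (0 :: real ^ 'd)" by (simp add: vec_eq_iff)
  then have "Poly_Mapping.lookup (poly_to_tensor p) [] = 0"
    using pairing_poly_to_tensor[of ?\<sigma> p] mult assms by (simp add: \<sigma>)
  then show ?thesis by (simp add: mem_tensor_ge1)
qed

section \<open>Controls of paths of finite variation\<close>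

text \<open>V s is the supremum of the q-variation sums over \<open>{0..s}\<close>. Appending the
  cell \<open>{a..b}\<close> to a division of \<open>{0..a}\<close> makes it superadditive, and this
  is the required bound.\<close>

lemma finite_variation_control:
  fixes X :: "real \<Rightarrow> 'a::real_normed_vector"
  assumes "finite_variation q T X" and q: "q > 0"
  obtains V where "mono_on {0..T} V"
    "\<And>a b. 0 \<le> a \<Longrightarrow> a \<le> b \<Longrightarrow> b \<le> T \<Longrightarrow> norm (X b - X a) powr q \<le> V b - V a"
proof -
  define S where "S = (\<lambda>D. \<Sum>K\<in>D. norm (X (Sup K) - X (Inf K)) powr q)"
  define V where "V = (\<lambda>s. SUP D\<in>{D. D division_of {0..s}}. S D)"
  obtain M where M: "\<And>D. D division_of {0..T} \<Longrightarrow> S D \<le> M"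
    using assms(1) unfolding finite_variation_def bdd_above_def S_def by blast
  \<comment> \<open>Strictness of a < b ensures that the new cell is not already in D, where it
    would be absorbed by the set and not be counted.\<close>
  have join: "insert {a..b} D division_of {0..b} \<and> S (insert {a..b} D) = S D + norm (X b - X a) powr q"
    if D: "D division_of {0..a}" and ab: "0 \<le> a" "a < b" for D a b
  proof
    have "{{a..b}} division_of {a..b}" using ab division_of_self[of a b] by simp
    then have "D \<union> {{a..b}} division_of {0..a} \<union> {a..b}"
      using D by (intro division_disjoint_union) (auto simp: interior_atLeastAtMost_real)
    moreover have "{0..a} \<union> {a..b} = {0..b}" using ab by auto
    ultimately show "insert {a..b} D division_of {0..b}" by simp
    have "{a..b} \<notin> D"
    proof
      assume "{a..b} \<in> D"
      then have "{a..b} \<subseteq> {0..a}" using D by (auto simp: division_of_def)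
      then show False using ab by auto
    qed
    then show "S (insert {a..b} D) = S D + norm (X b - X a) powr q"
      using division_of_finite[OF D] ab by (simp add: S_def)
  qed
  have bdd: "bdd_above (S ` {D. D division_of {0..s}})" if s: "0 \<le> s" "s \<le> T" for s
  proof (rule bdd_aboveI2)
    fix D assume D: "D \<in> {D. D division_of {0..s}}"
    show "S D \<le> M"
    proof (cases "s = T")
      case True
      then show ?thesis using D M by simp
    next
      case False
      then have j: "insert {s..T} D division_of {0..T}" "S (insert {s..T} D) = S D + norm (X T - X s) powr q"
        using join[of D s T] D s by auto
      then have "S D \<le> S (insert {s..T} D)" by simp
      also have "\<dots> \<le> M" using j(1) by (rule M)
      finally show ?thesis .
    qed
  qed
  have key: "norm (X b - X a) powr q \<le> V b - V a" if ab: "0 \<le> a" "a \<le> b" "b \<le> T" for a b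
  proof (cases "a = b")
    case True
    then show ?thesis using q by simp
  next
    case False
    then have "a < b" using ab by simp
    have "V a \<le> V b - norm (X b - X a) powr q"
      unfolding V_def
    proof (rule cSUP_least)
      show "{D. D division_of {0..a}} \<noteq> {}" using division_of_self[of 0 a] ab by auto
    next
      fix D assume "D \<in> {D. D division_of {0..a}}"
      then have j: "insert {a..b} D division_of {0..b}" "S (insert {a..b} D) = S D + norm (X b - X a) powr q"
        using join[of D a b] ab \<open>a < b\<close> by auto
      then have "S (insert {a..b} D) \<le> (SUP D\<in>{D. D division_of {0..b}}. S D)"
        using ab by (intro cSUP_upper bdd) auto
      then show "S D \<le> (SUP D\<in>{D. D division_of {0..b}}. S D) - norm (X b - X a) powr q"
        using j(2) by simp
    qed
    then show ?thesis by simp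
  qed
  show thesis
  proof (rule that[OF _ key])
    show "mono_on {0..T} V"
    proof (rule mono_onI)
      fix a b assume "a \<in> {0..T}" "b \<in> {0..T}" "a \<le> b"
      then have "norm (X b - X a) powr q \<le> V b - V a" by (intro key) auto
      then show "V a \<le> V b" using powr_ge_zero[of "norm (X b - X a)" q] by linarith
    qed
  qed
qed

text \<open>The converse: increments of W telescope over a division, so W T - W 0 bounds all
  variation sums.\<close>

lemma control_finite_variation:
  fixes X :: "real \<Rightarrow> 'a::real_normed_vector"
  assumes T: "0 \<le> T"
    and X: "\<And>a b. 0 \<le> a \<Longrightarrow> a \<le> b \<Longrightarrow> b \<le> T \<Longrightarrow> norm (X b - X a) powr q \<le> W b - (W a :: real)"
  shows "finite_variation q T X"
  unfolding finite_variation_def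
proof (rule bdd_aboveI)
  fix r assume "r \<in> {\<Sum>K\<in>D. norm (X (Sup K) - X (Inf K)) powr q | D. D division_of {0..T}}"
  then obtain D where D: "D division_of {0..T}" and r: "r = (\<Sum>K\<in>D. norm (X (Sup K) - X (Inf K)) powr q)"
    by blast
  \<comment> \<open>Left end points serve as tags, only to make the telescoping law for tagged
    divisions applicable.\<close>
  define p where "p = (\<lambda>K. (Inf K, K)) ` D"
  have K: "\<exists>a b. K = {a..b} \<and> 0 \<le> a \<and> a \<le> b \<and> b \<le> T" if KD: "K \<in> D" for K
  proof -
    obtain a b where ab: "K = {a..b}" using division_ofD(4)[OF D KD] by auto
    moreover have "K \<noteq> {}" "K \<subseteq> {0..T}" using division_ofD(2,3)[OF D KD] by auto
    ultimately show ?thesis by auto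
  qed
  have "p tagged_division_of {0..T}"
  proof (rule tagged_division_ofI)
    show "finite p" using division_of_finite[OF D] by (simp add: p_def)
    have "{K. \<exists>x. (x, K) \<in> p} = D" by (auto simp: p_def image_iff)
    then show "\<Union>{K. \<exists>x. (x, K) \<in> p} = {0..T}" using division_ofD(6)[OF D] by simp
  next
    fix x L assume "(x, L) \<in> p"
    then have L: "L \<in> D" "x = Inf L" by (auto simp: p_def)
    then show "x \<in> L" "L \<subseteq> {0..T}" using K[OF L(1)] by auto
    show "\<exists>a b. L = cbox a b" using K[OF L(1)] by auto
  next
    fix x1 K1 x2 K2 assume "(x1, K1) \<in> p" "(x2, K2) \<in> p" "(x1, K1) \<noteq> (x2, K2)"
    then show "interior K1 \<inter> interior K2 = {}"
      using division_ofD(5)[OF D] by (auto simp: p_def)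
  qed
  from additive_tagged_division_1[OF T this, of W]
  have "(\<Sum>K\<in>D. W (Sup K) - W (Inf K)) = W T - W 0"
    unfolding p_def by (subst (asm) sum.reindex) (auto intro: inj_onI)
  moreover have "r \<le> (\<Sum>K\<in>D. W (Sup K) - W (Inf K))"
    unfolding r using K X by (intro sum_mono) fastforce
  ultimately show "r \<le> W T - W 0" by simp
qed

section \<open>Signatures\<close>

lemma iterated_integral_rev_cong:
  assumes "\<And>r. r \<in> {0..s} \<Longrightarrow> X r = Y r" "r \<in> {0..s}"
  shows "iterated_integral_rev w X r = iterated_integral_rev w Y r"
  using assms(2)
proof (induction w arbitrary: r)
  case (Cons i w)
  have "RS_integral (\<lambda>r. iterated_integral_rev w X r) (\<lambda>r. X r $ i) 0 r =
      RS_integral (\<lambda>r. iterated_integral_rev w Y r) (\<lambda>r. Y r $ i) 0 r"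
    using Cons assms(1) by (intro RS_integral_cong) auto
  then show ?case by simp
qed simp

text \<open>Integrals up to s see the path on \<open>{0..s}\<close> only. The signatures of all
  stopped paths thus become functions of time along one path.\<close>

lemma signature_stopped:
  assumes "0 \<le> s"
  shows "signature (stopped s X) = (\<lambda>w. iterated_integral_rev (rev w) (snd X) s)"
  unfolding signature_def stopped_def
  by (rule ext, simp, rule iterated_integral_rev_cong[where s = s]) (use assms in auto)

context young
begin

lemma controlled_cong:
  assumes "controlled f" "\<And>s. s \<in> {0..T} \<Longrightarrow> f s = g s"
  shows "controlled g"
proof -
  obtain K where K: "K \<ge> 0" "\<And>a b. 0 \<le> a \<Longrightarrow> a \<le> b \<Longrightarrow> b \<le> T \<Longrightarrow> \<bar>f b - f a\<bar> \<le> K * (V b - V a) powr \<alpha>"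
    using assms(1) unfolding controlled_def by blast
  then have "\<bar>g b - g a\<bar> \<le> K * (V b - V a) powr \<alpha>" if "0 \<le> a" "a \<le> b" "b \<le> T" for a b
    using that assms(2)[of a] assms(2)[of b] K(2)[OF that] by simp
  moreover have "continuous_on {0..T} f = continuous_on {0..T} g"
    by (rule continuous_on_cong[OF refl assms(2)])
  then have "continuous_on {0..T} g" using controlled_continuous[OF assms(1)] by simp
  ultimately show ?thesis using K(1) unfolding controlled_def by blast
qed

lemma primitive_shift: "primitive f g F \<Longrightarrow> primitive f (\<lambda>s. g s - c) F"
  unfolding primitive_def by simp

lemma primitive_RS_integral:
  assumes "controlled f" "controlled g"
  shows "primitive f g (RS_integral f g 0)" "controlled (RS_integral f g 0)"
proof -
  obtain F where F: "primitive f g F" "controlled F" using primitive_exists[OF assms] by blast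
  have eq: "F s = RS_integral f g 0 s" if "s \<in> {0..T}" for s
    using RS_integral_primitive[OF F(1)] that by simp
  show "primitive f g (RS_integral f g 0)" by (rule primitive_cong[OF F(1) refl refl eq])
  show "controlled (RS_integral f g 0)" by (rule controlled_cong[OF F(2) eq])
qed

end

section \<open>The signature as a function of time\<close>

locale young_path = young T \<alpha> V for T \<alpha> :: real and V :: "real \<Rightarrow> real" +
  fixes X :: "real \<Rightarrow> real ^ 'd::finite"
  assumes X: "\<And>i. controlled (\<lambda>s. X s $ i)"
begin

definition sig :: "real \<Rightarrow> 'd dual_tensor"
  where "sig s = (\<lambda>w. iterated_integral_rev (rev w) X s)"

lemma sig_Nil [simp]: "sig s [] = 1"
  by (simp add: sig_def)

lemma sig_snoc: "(\<lambda>s. sig s (w @ [i])) = RS_integral (\<lambda>s. sig s w) (\<lambda>s. X s $ i) 0"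
  by (simp add: sig_def)

lemma controlled_sig: "controlled (\<lambda>s. sig s w)"
proof (induction w rule: rev_induct)
  case Nil
  then show ?case by (simp add: controlled_const)
next
  case (snoc i w)
  then show ?case unfolding sig_snoc by (intro primitive_RS_integral X)
qed

lemma primitive_sig_snoc: "primitive (\<lambda>s. sig s w) (\<lambda>s. X s $ i) (\<lambda>s. sig s (w @ [i]))"
  unfolding sig_snoc by (intro primitive_RS_integral X controlled_sig)

lemma sig_letter: "s \<in> {0..T} \<Longrightarrow> sig s [i] = X s $ i - X 0 $ i"
  using primitive_unique[OF primitive_sig_snoc[of "[]" i, simplified] primitive_one] by simp

lemma sig_0: "sig 0 w = (if w = [] then 1 else 0)"
  using primitive_0[OF primitive_sig_snoc] by (cases w rule: rev_cases) auto

lemma pairing_sig: "pairing (sig s) x = (\<Sum>w\<in>Poly_Mapping.keys x. Poly_Mapping.lookup x w * sig s w)"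
  by (rule pairing_def)

lemma pairing_sig_0: "pairing (sig 0) x = Poly_Mapping.lookup x []"
  unfolding pairing_sig sig_0 by (auto simp: in_keys_iff if_distrib[of "(*) _"] cong: if_cong)

lemma controlled_pairing: "controlled (\<lambda>s. pairing (sig s) x)"
  unfolding pairing_sig by (intro controlled_sum controlled_sig finite_keys)

lemma primitive_append_letter:
  "primitive (\<lambda>s. pairing (sig s) x) (\<lambda>s. X s $ i) (\<lambda>s. pairing (sig s) (append_letter x i))"
proof -
  have "pairing (sig s) (append_letter x i) =
      (\<Sum>w\<in>Poly_Mapping.keys x. Poly_Mapping.lookup x w * sig s (w @ [i]))" for s
    unfolding append_letter_def linear_ext_def
    by (simp add: linear_sum[OF linear_pairing] linear_scale[OF linear_pairing])
  then show ?thesis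
    unfolding pairing_sig[of _ x] by (simp only: primitive_sum_left finite_keys primitive_sig_snoc)
qed

text \<open>For v = u @ [i] the integral of w against v is that of the product of w and u against
  the coordinate i. By induction and parts the product is the sum of both halfshuffles of w and u,
  and appending i yields the recursion. The induction is on the total length because w and u
  exchange roles.\<close>

lemma primitive_halfshuffle_word:
  "w \<noteq> [] \<Longrightarrow> v \<noteq> [] \<Longrightarrow>
    primitive (\<lambda>s. sig s w) (\<lambda>s. sig s v) (\<lambda>s. pairing (sig s) (halfshuffle_word w v))"
proof (induction "length w + length v" arbitrary: w v rule: less_induct)
  case less
  obtain u i where v: "v = u @ [i]" using less.prems(2) by (metis rev_exhaust)
  show ?case
  proof (cases "u = []")
    case True
    \<comment> \<open>On a letter \<open>sig\<close> differs from the coordinate of X by a constant,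
      which does not affect integration.\<close>
    have "primitive (\<lambda>s. sig s w) (\<lambda>s. X s $ i - X 0 $ i) (\<lambda>s. sig s (w @ [i]))"
      by (rule primitive_shift[OF primitive_sig_snoc])
    then show ?thesis
      by (rule primitive_cong) (use True less.prems in \<open>simp_all add: v sig_letter halfshuffle_word_letter\<close>)
  next
    case False
    let ?S = "halfshuffle_word w u + halfshuffle_word u w"
    have "primitive (\<lambda>s. sig s w) (\<lambda>s. sig s u) (\<lambda>s. pairing (sig s) (halfshuffle_word w u))"
      "primitive (\<lambda>s. sig s u) (\<lambda>s. sig s w) (\<lambda>s. pairing (sig s) (halfshuffle_word u w))"
      using less.hyps[of w u] less.hyps[of u w] less.prems False by (simp_all add: v)
    from integration_by_parts[OF this]
    \<comment> \<open>The boundary term at 0 vanishes because w and u are nonempty.\<close>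
    have prod: "pairing (sig s) ?S = sig s w * sig s u" if "s \<in> {0..T}" for s
      using that less.prems by (simp add: linear_add[OF linear_pairing] sig_0)
    have 1: "primitive (\<lambda>s. sig s w * sig s u) (\<lambda>s. X s $ i) (\<lambda>s. pairing (sig s) (append_letter ?S i))"
      by (rule primitive_cong[OF primitive_append_letter prod]) auto
    obtain G where G: "primitive (\<lambda>s. sig s w) (\<lambda>s. sig s v) G"
      using primitive_exists[OF controlled_sig controlled_sig] by blast
    \<comment> \<open>G integrates w against v, and v in turn integrates u against X; associativity
      merges the two. Uniqueness then identifies G with the tensor expression from
      \<open>1\<close>.\<close>
    have 2: "primitive (\<lambda>s. sig s w * sig s u) (\<lambda>s. X s $ i) G"
      by (rule primitive_assoc[OF primitive_sig_snoc G[unfolded v] controlled_continuous[OF controlled_sig]])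
    show ?thesis
      by (rule primitive_cong[OF G refl refl])
        (use primitive_unique[OF 2 1] False less.prems in \<open>simp add: v halfshuffle_word_snoc\<close>)
  qed
qed

text \<open>Membership in \<open>tensor_ge1\<close> keeps the bilinear expansion away from empty
  words, on which \<open>halfshuffle_word\<close> has a dummy value.\<close>

lemma primitive_halfshuffle:
  assumes "x \<in> tensor_ge1" "y \<in> tensor_ge1"
  shows "primitive (\<lambda>s. pairing (sig s) x) (\<lambda>s. pairing (sig s) y) (\<lambda>s. pairing (sig s) (halfshuffle x y))"
proof -
  have ne: "w \<noteq> []" if "w \<in> Poly_Mapping.keys x \<union> Poly_Mapping.keys y" for w
    using that assms by (auto simp: mem_tensor_ge1 in_keys_iff)
  have "pairing (sig s) (halfshuffle x y) = (\<Sum>w\<in>Poly_Mapping.keys x. Poly_Mapping.lookup x w *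
      (\<Sum>v\<in>Poly_Mapping.keys y. Poly_Mapping.lookup y v * pairing (sig s) (halfshuffle_word w v)))" for s
    unfolding halfshuffle_def bilinear_ext_def
    by (simp add: linear_sum[OF linear_pairing] linear_scale[OF linear_pairing] sum_distrib_left mult.assoc)
  then show ?thesis
    unfolding pairing_sig[of _ x] pairing_sig[of _ y]
    by (simp only:) (intro primitive_sum_left primitive_sum_right primitive_halfshuffle_word finite_keys ne UnI1 UnI2)
qed

lemma pairing_shuffle:
  assumes s: "s \<in> {0..T}"
  shows "pairing (sig s) (shuffle x y) = pairing (sig s) x * pairing (sig s) y"
proof (rule bilinear_eq_on_basis[OF bilinear_compose_linear[OF bilinear_shuffle linear_pairing]
      bilinear_compose[OF bilinear_times linear_pairing linear_pairing]])
  fix w v :: "'d list"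
  show "pairing (sig s) (shuffle (Poly_Mapping.single w 1) (Poly_Mapping.single v 1)) =
      pairing (sig s) (Poly_Mapping.single w 1) * pairing (sig s) (Poly_Mapping.single v 1)"
    unfolding word_def[symmetric] shuffle_word
    using integration_by_parts[OF primitive_halfshuffle_word primitive_halfshuffle_word, of w v s] s
    by (auto simp: linear_add[OF linear_pairing] sig_0)
qed

text \<open>The coefficient of the empty word is the pairing with the signature at time 0, and there
  a primitive vanishes.\<close>

lemma halfshuffle_tensor_ge1:
  fixes x y :: "'d tensor"
  assumes "x \<in> tensor_ge1" "y \<in> tensor_ge1"
  shows "halfshuffle x y \<in> tensor_ge1"
  using primitive_0[OF primitive_halfshuffle[OF assms]] by (simp add: pairing_sig_0 mem_tensor_ge1)

lemma iterated_integral_Lambda: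
  fixes Z :: "real \<Rightarrow> real ^ 't::finite"
  assumes B: "range B \<subseteq> tensor_ge1"
    and Z: "\<And>r i. r \<in> {0..T} \<Longrightarrow> Z r $ i = pairing (sig r) (B (axis i 1))"
    and s: "s \<in> {0..T}"
  shows "iterated_integral_rev w Z s = pairing (sig s) (Lambda_rev B w)"
proof -
  have Bge1: "B x \<in> tensor_ge1" for x using B by auto
  \<comment> \<open>Only for nonempty words: \<open>Lambda_rev B []\<close> is the empty word
    itself.\<close>
  have ge1: "Lambda_rev B (i # w) \<in> tensor_ge1" for i w
    by (induction w arbitrary: i) (simp_all add: Bge1 halfshuffle_tensor_ge1)
  show ?thesis
    using s
  proof (induction w arbitrary: s)
    case Nil
    then show ?case by simp
  next
    case (Cons i w)
    have RS: "iterated_integral_rev (i # w) Z s =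
        RS_integral (\<lambda>r. pairing (sig r) (Lambda_rev B w)) (\<lambda>r. pairing (sig r) (B (axis i 1))) 0 s"
      using Cons by (simp, intro RS_integral_cong) (auto simp: Z)
    have "primitive (\<lambda>r. pairing (sig r) (Lambda_rev B w)) (\<lambda>r. pairing (sig r) (B (axis i 1)))
        (\<lambda>r. pairing (sig r) (Lambda_rev B (i # w)))"
    \<comment> \<open>For a single letter no halfshuffle occurs: the integrand is 1 and the integral
      is the pairing with B at that letter minus its value at time 0, which is 0.\<close>
    proof (cases w)
      case Nil
      have "pairing (sig 0) (B (axis i 1)) = 0" using Bge1 by (simp add: pairing_sig_0 mem_tensor_ge1)
      then show ?thesis using primitive_one[of "\<lambda>r. pairing (sig r) (B (axis i 1))"] Nil by simp
    next
      case (Cons j u)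
      then show ?thesis by (simp add: primitive_halfshuffle ge1 Bge1)
    qed
    from RS_integral_primitive[OF this] show ?case using Cons.prems by (simp only: RS atLeastAtMost_iff)
  qed
qed

text \<open>The variation exponent is 1/\<alpha>, and a multiple of V serves as control: raising the
  bound for the increments to this power makes it linear in V b - V a.\<close>

lemma path_from_controlled:
  fixes Z :: "real \<Rightarrow> real ^ 't::finite"
  assumes Z: "\<And>i. controlled (\<lambda>s. Z s $ i)" and ext: "Z \<in> extensional {0..T}"
  shows "(T, Z) \<in> paths"
proof -
  have "\<exists>K. K > 0 \<and> (\<forall>a b. 0 \<le> a \<longrightarrow> a \<le> b \<longrightarrow> b \<le> T \<longrightarrow> \<bar>Z b $ i - Z a $ i\<bar> \<le> K * (V b - V a) powr \<alpha>)" for i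
  proof -
    obtain K where "K > 0" "\<And>a b x y. 0 \<le> a \<Longrightarrow> b \<le> T \<Longrightarrow> x \<in> {a..b} \<Longrightarrow> y \<in> {a..b} \<Longrightarrow>
      \<bar>Z x $ i - Z y $ i\<bar> \<le> K * (V b - V a) powr \<alpha>" using controlled_bound[OF Z] by blast
    then show ?thesis by (intro exI[of _ K]) auto
  qed
  then obtain K where K: "\<And>i. K i > 0"
    "\<And>i a b. 0 \<le> a \<Longrightarrow> a \<le> b \<Longrightarrow> b \<le> T \<Longrightarrow> \<bar>Z b $ i - Z a $ i\<bar> \<le> K i * (V b - V a) powr \<alpha>"
    by metis
  define L where "L = (\<Sum>i\<in>UNIV. K i)"
  have L: "L \<ge> 0" unfolding L_def using K(1) by (intro sum_nonneg) (auto intro: less_imp_le)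
  have "finite_variation (1 / \<alpha>) T Z"
  proof (rule control_finite_variation)
    show "0 \<le> T" using T by simp
  next
    fix a b :: real assume ab: "0 \<le> a" "a \<le> b" "b \<le> T"
    have "norm (Z b - Z a) \<le> (\<Sum>i\<in>UNIV. \<bar>(Z b - Z a) $ i\<bar>)" by (rule norm_le_l1_cart)
    also have "\<dots> \<le> (\<Sum>i\<in>UNIV. K i * (V b - V a) powr \<alpha>)"
      by (rule sum_mono) (simp add: K(2) ab)
    also have "\<dots> = L * (V b - V a) powr \<alpha>" by (simp add: L_def sum_distrib_right)
    finally have "norm (Z b - Z a) powr (1 / \<alpha>) \<le> (L * (V b - V a) powr \<alpha>) powr (1 / \<alpha>)"
      using \<alpha> by (intro powr_mono2) auto
    also have "\<dots> = L powr (1 / \<alpha>) * V b - L powr (1 / \<alpha>) * V a"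
      using L \<alpha> VD[OF ab] by (simp add: powr_mult powr_powr right_diff_distrib)
    finally show "norm (Z b - Z a) powr (1 / \<alpha>) \<le> L powr (1 / \<alpha>) * V b - L powr (1 / \<alpha>) * V a" .
  qed
  moreover have "1 \<le> 1 / \<alpha>" "1 / \<alpha> < 2" using \<alpha> by (auto simp: field_simps)
  moreover have "continuous_on {0..T} (\<lambda>s. \<chi> i. Z s $ i)"
    by (intro continuous_on_vec_lambda controlled_continuous[OF Z])
  then have "continuous_on {0..T} Z" by simp
  ultimately show ?thesis using T ext unfolding paths_def by blast
qed

end

lemma path_young:
  assumes "(T, X) \<in> paths"
  obtains \<alpha> V where "young_path T \<alpha> V X"
proof -
  obtain q where T: "T > 0" and X: "continuous_on {0..T} X" and q: "1 \<le> q" "q < 2" "finite_variation q T X"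
    using assms unfolding paths_def by blast
  obtain V where mono: "mono_on {0..T} V" and
    control: "\<And>a b. 0 \<le> a \<Longrightarrow> a \<le> b \<Longrightarrow> b \<le> T \<Longrightarrow> norm (X b - X a) powr q \<le> V b - V a"
    using finite_variation_control[OF q(3)] q by auto
  \<comment> \<open>The range of q in the definition of \<open>paths\<close> is exactly the range of
    \<alpha> = 1/q in the locale.\<close>
  interpret young T "1 / q" V
    using T mono q by unfold_locales (auto simp: field_simps)
  have "young_path T (1 / q) V X"
  proof
    fix i
    have "\<bar>X b $ i - X a $ i\<bar> \<le> 1 * (V b - V a) powr (1 / q)" if ab: "0 \<le> a" "a \<le> b" "b \<le> T" for a b
    proof -
      have "\<bar>X b $ i - X a $ i\<bar> \<le> norm (X b - X a)"
        using component_le_norm_cart[of "X b - X a" i] by simp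
      also have "\<dots> = (norm (X b - X a) powr q) powr (1 / q)" using q by (simp add: powr_powr)
      also have "\<dots> \<le> (V b - V a) powr (1 / q)" using control[OF ab] q by (intro powr_mono2) auto
      finally show ?thesis by simp
    qed
    moreover have "continuous_on {0..T} (\<lambda>s. X s $ i)" using X by (intro continuous_intros)
    ultimately show "controlled (\<lambda>s. X s $ i)" unfolding controlled_def using zero_le_one by blast
  qed
  then show thesis by (rule that)
qed

section \<open>Pullbacks of path varieties\<close>

lemma Lambda_star_path:
  fixes B :: "real ^ ('t::finite) \<Rightarrow> ('d::finite) tensor"
  assumes X: "X \<in> paths" and B: "range B \<subseteq> tensor_ge1"
  shows "Lambda_star B X \<in> paths"
    and "pairing (signature (Lambda_star B X)) x = pairing (signature X) (Lambda B x)"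
proof -
  obtain T Y where TY: "X = (T, Y)" by fastforce
  obtain \<alpha> V where "young_path T \<alpha> V Y" using path_young X TY by blast
  then interpret young_path T \<alpha> V Y .
  define Z where "Z = restrict (\<lambda>s. \<chi> i. pairing (signature (stopped s X)) (B (axis i 1))) {0..T}"
  have star: "Lambda_star B X = (T, Z)" by (simp add: Lambda_star_def TY Z_def)
  have Z: "Z s $ i = pairing (sig s) (B (axis i 1))" if "s \<in> {0..T}" for s i
    using that by (simp add: Z_def signature_stopped TY sig_def)
  have "controlled (\<lambda>s. Z s $ i)" for i
    using Z[symmetric] by (rule controlled_cong[OF controlled_pairing])
  then show "Lambda_star B X \<in> paths"
    unfolding star by (rule path_from_controlled) (unfold Z_def, rule restrict_extensional)
  have T0: "T \<in> {0..T}" using T by simp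
  have "signature (Lambda_star B X) w = pairing (signature X) (Lambda B (word w))" for w
    using iterated_integral_Lambda[OF B Z T0, of "rev w"]
    by (simp add: star[unfolded TY] signature_def TY sig_def Lambda_def)
  then have words: "pairing (signature (Lambda_star B X)) (word w) = pairing (signature X) (Lambda B (word w))" for w
    by simp
  have lin: "linear (\<lambda>x. pairing (signature X) (Lambda B x))"
    unfolding Lambda_def by (rule linear_compose[OF linear_linear_ext linear_pairing, unfolded o_def])
  show "pairing (signature (Lambda_star B X)) x = pairing (signature X) (Lambda B x)"
    by (rule linear_eq_on_basis[OF linear_pairing lin]) (rule words[unfolded word_def])
qed

text \<open>Pulling back along \<open>Lambda_star B\<close> is adjoint to applying
  \<open>Lambda B\<close>. A path variety is the zero set of its own vanishing ideal, so membership
  in V may be tested on \<open>vanishing V\<close>.\<close>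

lemma Lambda_star_variety:
  fixes V :: "('t::finite) path_fun set" and B :: "real ^ 't \<Rightarrow> ('d::finite) tensor"
  assumes "path_variety V" and B: "range B \<subseteq> tensor_ge1"
  shows "{X \<in> paths. Lambda_star B X \<in> V} = variety (Lambda B ` vanishing V)"
proof -
  obtain W where W: "V = variety W" using assms(1) unfolding path_variety_def by blast
  have "Lambda_star B X \<in> V \<longleftrightarrow> (\<forall>x\<in>vanishing V. pairing (signature X) (Lambda B x) = 0)"
    if X: "X \<in> paths" for X
  proof
    assume "Lambda_star B X \<in> V"
    then show "\<forall>x\<in>vanishing V. pairing (signature X) (Lambda B x) = 0"
      unfolding vanishing_def Lambda_star_path(2)[OF X B, symmetric] by blast
  next
    assume *: "\<forall>x\<in>vanishing V. pairing (signature X) (Lambda B x) = 0"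
    \<comment> \<open>The converse direction tests only the equations W that define V.\<close>
    have "W \<subseteq> vanishing V" unfolding W vanishing_def variety_def by blast
    with * show "Lambda_star B X \<in> V"
      using Lambda_star_path(1)[OF X B]
      unfolding W variety_def Lambda_star_path(2)[OF X B, symmetric] by blast
  qed
  then show ?thesis unfolding variety_def[of "Lambda B ` vanishing V"] by auto
qed

text \<open>At each time the signature is a shuffle character whose values on the letters are the
  coordinates of Y s - Y 0, so pairing with \<open>poly_to_tensor (p i)\<close> evaluates p i
  there.\<close>

lemma poly_path_eq_Lambda_star:
  fixes p :: "'t::finite \<Rightarrow> ('d::finite) poly_ring"
  assumes X: "X \<in> paths"
  shows "poly_path p X = Lambda_star (\<lambda>v. \<Sum>i\<in>UNIV. (v $ i) *\<^sub>R poly_to_tensor (p i)) X"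
proof -
  obtain T Y where TY: "X = (T, Y)" by fastforce
  obtain \<alpha> V where "young_path T \<alpha> V Y" using path_young X TY by blast
  then interpret young_path T \<alpha> V Y .
  have axis: "(\<Sum>j\<in>UNIV. (axis i 1 $ j) *\<^sub>R poly_to_tensor (p j)) = poly_to_tensor (p i)" for i
    by (simp add: axis_def if_distrib[of "\<lambda>c. c *\<^sub>R _"] cong: if_cong)
  have "poly_eval (p i) (Y s - Y 0) = pairing (sig s) (poly_to_tensor (p i))" if s: "s \<in> {0..T}" for s i
  proof -
    have "(\<chi> j. sig s [j]) = Y s - Y 0" using s by (simp add: vec_eq_iff sig_letter)
    then show ?thesis using pairing_poly_to_tensor[of "sig s" "p i"] pairing_shuffle[OF s] by simp
  qed
  then show ?thesis
    unfolding poly_path_def Lambda_star_def axis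
    by (auto simp: TY poly_map_def signature_stopped sig_def intro!: restrict_ext)
qed

theorem theorem8p6:
  fixes V :: "('t::finite) path_fun set"
  assumes "path_variety V"
  shows "(\<forall>p :: 't \<Rightarrow> ('d::finite) poly_ring. poly_map p 0 = 0 \<longrightarrow>
            path_variety {X \<in> paths. poly_path p X \<in> V} \<and>
            {X \<in> paths. poly_path p X \<in> V} = variety (M_map p ` vanishing V)) \<and>
         (\<forall>B :: real ^ 't \<Rightarrow> 'd tensor. linear B \<and> range B \<subseteq> tensor_ge1 \<longrightarrow>
            path_variety {X \<in> paths. Lambda_star B X \<in> V} \<and>
            {X \<in> paths. Lambda_star B X \<in> V} = variety (Lambda B ` vanishing V))"
proof (intro conjI allI impI; (elim conjE)?)
  fix p :: "'t \<Rightarrow> 'd poly_ring" assume p: "poly_map p 0 = 0"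
  have "poly_eval (p i) 0 = 0" for i using p by (simp add: poly_map_def vec_eq_iff)
  \<comment> \<open>p 0 = 0 removes the constant terms, so that the map from which
    \<open>M_map p\<close> is formed has values in \<open>tensor_ge1\<close> and the general
    pullback applies.\<close>
  then have "range (\<lambda>v :: real ^ 't. \<Sum>i\<in>UNIV. (v $ i) *\<^sub>R poly_to_tensor (p i)) \<subseteq> tensor_ge1"
    unfolding tensor_ge1_def
    by (auto intro!: span_sum span_scale poly_to_tensor_ge1[unfolded tensor_ge1_def])
  from Lambda_star_variety[OF assms this]
  show *: "{X \<in> paths. poly_path p X \<in> V} = variety (M_map p ` vanishing V)"
    unfolding M_map_def by (simp add: poly_path_eq_Lambda_star cong: conj_cong)
  show "path_variety {X \<in> paths. poly_path p X \<in> V}"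
    unfolding * path_variety_def by blast
next
  fix B :: "real ^ 't \<Rightarrow> 'd tensor" assume B: "range B \<subseteq> tensor_ge1"
  show *: "{X \<in> paths. Lambda_star B X \<in> V} = variety (Lambda B ` vanishing V)"
    by (rule Lambda_star_variety[OF assms B])
  show "path_variety {X \<in> paths. Lambda_star B X \<in> V}"
    unfolding * path_variety_def by blast
qed

end
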